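(* Let $g\in C(\mathbb{A}/\mathbb{Q},S^1)$ and $x_f\in\mathbb{A}_f$. Then the function $g_{x_f}\in C(\mathbb{R},S^1)$ given by $$g_{x_f}(x_\infty):=g(\{x_\infty,x_f\})$$ is a pre-periodic function. Furthermore, for every $x_f\in\mathbb{A}_f$ we have $\#g_{x_f}=\#g_{0_f}$, where $0_f$ is the zero element of $\mathbb{A}_f$ (the embedding of $0$ in $\mathbb{A}_f$).
   Context: $\mathbb{A}=\mathbb{R}\times\mathbb{A}_f$ is the adele ring of $\mathbb{Q}$ with the restricted product topology, $\mathbb{A}_f$ the finite adeles; elements are written $\{x_\infty,x_f\}$ with $x_\infty\in\mathbb{R}$, $x_f\in\mathbb{A}_f$. $\mathbb{Q}$ is embedded diagonally in $\mathbb{A}$, and an element of $C(\mathbb{A}/\mathbb{Q},S^1)$ is identified with a continuous function $g:\mathbb{A}\to S^1$ satisfying $g(x+\alpha)=g(x)$ for all $\alpha\in\mathbb{Q}$. A function $f\in C(\mathbb{R},S^1)$ is pre-periodic if for every $\varepsilon>0$ there exists a positive integer $N$ such that $|f(x+kN)-f(x)|<\varepsilon$ for all $k\in\mathbb{Z}$, $x\in\mathbb{R}$. For pre-periodic $f$, the generalized winding number is $$\#f=\lim_{x\to+\infty}\frac{\tilde f(x)-\tilde f(-x)}{2x},$$ where $\tilde f\in C(\mathbb{R},\mathbb{R})$ is any lift of $f$, i.e. $e^{2\pi i\tilde f}=f$ (the limit exists and does not depend on the lift). (Accordingly the generalized winding number of $g\in C(\mathbb{A}/\mathbb{Q},S^1)$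 is defined as $\#g:=\#g_{0_f}$.) *)

theory Defs
  imports "HOL-Analysis.Analysis" "HOL-Computational_Algebra.Primes"
begin

section \<open>The \<open>p\<close>-adic absolute value on the rationals\<close>

text \<open>\<open>\<bar>a/b\<bar>\<^sub>p = p\<^bsup>v(b) - v(a)\<^esup>\<close>; only prime \<open>p\<close> are of interest, here and below.\<close>

definition padic_abs :: "nat \<Rightarrow> rat \<Rightarrow> real" where
  "padic_abs p x =
     (if x = 0 then 0
      else real p powi (int (multiplicity (int p) (snd (quotient_of x)))
                        - int (multiplicity (int p) (fst (quotient_of x)))))"

lemma padic_abs_0 [simp]: "padic_abs p 0 = 0"
  by (simp add: padic_abs_def)

lemma padic_abs_nonneg [simp]: "0 \<le> padic_abs p x"
  by (simp add: padic_abs_def)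

lemma padic_abs_frac:
  assumes p: "prime p" and a: "a \<noteq> 0" and b: "b \<noteq> 0"
  shows "padic_abs p (of_int a / of_int b) =
           real p powi (int (multiplicity (int p) b) - int (multiplicity (int p) a))"
proof -
  define x :: rat where "x = of_int a / of_int b"
  obtain c d where cd: "quotient_of x = (c, d)" by fastforce
  have d: "d > 0" using cd quotient_of_denom_pos by blast
  have xcd: "x = of_int c / of_int d" using cd by (rule quotient_of_div)
  have x0: "x \<noteq> 0" using a b by (simp add: x_def)
  then have c: "c \<noteq> 0" using xcd by auto
  have "(of_int a :: rat) * of_int d = of_int c * of_int b"
    using xcd b d by (simp add: x_def field_simps)
  then have eq: "a * d = c * b"
    by (metis of_int_eq_iff of_int_mult)
  have pe: "prime_elem (int p)" using p by auto
  have "multiplicity (int p) a + multiplicity (int p) d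
      = multiplicity (int p) c + multiplicity (int p) b"
    using arg_cong [OF eq, of "multiplicity (int p)"] a b c d
    by (simp add: prime_elem_multiplicity_mult_distrib [OF pe])
  then have "int (multiplicity (int p) d) - int (multiplicity (int p) c)
      = int (multiplicity (int p) b) - int (multiplicity (int p) a)"
    by linarith
  then show ?thesis
    using x0 cd unfolding x_def padic_abs_def by simp
qed

lemma padic_abs_eq_0_iff:
  assumes "prime p" shows "padic_abs p x = 0 \<longleftrightarrow> x = 0"
  using prime_gt_0_nat [OF assms] by (auto simp: padic_abs_def)

lemma rat_frac_cases:
  obtains a b where "b \<noteq> 0" "(x::rat) = of_int a / of_int b"
  by (metis quotient_of_denom_pos quotient_of_div surj_pair less_irrefl)

lemma padic_abs_mult:
  assumes p: "prime p" shows "padic_abs p (x * y) = padic_abs p x * padic_abs p y"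
proof (cases "x = 0 \<or> y = 0")
  case False
  obtain a b where ab: "b \<noteq> 0" "x = of_int a / of_int b" by (rule rat_frac_cases)
  obtain c d where cd: "d \<noteq> 0" "y = of_int c / of_int d" by (rule rat_frac_cases)
  have ac: "a \<noteq> 0" "c \<noteq> 0" using False ab cd by auto
  have pe: "prime_elem (int p)" using p by auto
  have xy: "x * y = of_int (a * c) / of_int (b * d)" using ab cd by simp
  have p0: "real p \<noteq> 0" using prime_gt_0_nat [OF p] by simp
  show ?thesis
    unfolding xy unfolding ab(2) cd(2)
    using ac ab(1) cd(1) p0
    by (simp add: padic_abs_frac p prime_elem_multiplicity_mult_distrib [OF pe]
          flip: of_int_mult power_int_add) (simp add: algebra_simps)
qed auto

lemma padic_abs_minus [simp]: "padic_abs p (- x) = padic_abs p x"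
proof -
  have "multiplicity (int p) (- a) = multiplicity (int p) a" for a
    by (metis abs_minus_cancel multiplicity_normalize_right normalize_int_def)
  then show ?thesis
    by (cases "quotient_of x") (auto simp: padic_abs_def rat_uminus_code)
qed

lemma padic_abs_diff_commute: "padic_abs p (x - y) = padic_abs p (y - x)"
  using padic_abs_minus [of p "x - y"] by simp

lemma padic_abs_add:
  assumes p: "prime p" shows "padic_abs p (x + y) \<le> max (padic_abs p x) (padic_abs p y)"
proof (cases "x = 0 \<or> y = 0 \<or> x + y = 0")
  case True
  then show ?thesis by (auto simp: le_max_iff_disj)
next
  case False
  obtain a b where ab: "b \<noteq> 0" "x = of_int a / of_int b" by (rule rat_frac_cases)
  obtain c d where cd: "d \<noteq> 0" "y = of_int c / of_int d" by (rule rat_frac_cases)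
  define A C E where "A = a * d" and "C = c * b" and "E = b * d"
  have E: "E \<noteq> 0" using ab cd by (simp add: E_def)
  have x: "x = of_int A / of_int E" and y: "y = of_int C / of_int E"
    using ab cd by (simp_all add: A_def C_def E_def)
  have xy: "x + y = of_int (A + C) / of_int E"
    using x y by (simp add: add_divide_distrib)
  have nz: "A \<noteq> 0" "C \<noteq> 0" "A + C \<noteq> 0"
    using False x y xy by auto
  let ?m = "multiplicity (int p)"
  have "int p ^ min (?m A) (?m C) dvd A + C"
    by (meson dvd_add min.cobounded1 min.cobounded2 multiplicity_dvd')
  moreover have "\<not> is_unit (int p)" using p prime_gt_1_nat [OF p] by simp
  ultimately have "min (?m A) (?m C) \<le> ?m (A + C)"
    using nz by (simp add: multiplicity_geI)
  then have "?m A \<le> ?m (A + C) \<or> ?m C \<le> ?m (A + C)" by linarith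
  moreover have p1: "1 \<le> real p" using prime_ge_1_nat [OF p] by simp
  have mono: "real p powi (int (?m E) - int k) \<le> real p powi (int (?m E) - int l)" if "l \<le> k" for k l
    using that p1 by (intro power_int_increasing) auto
  ultimately show ?thesis
    unfolding xy unfolding x y using nz E
    by (auto simp: padic_abs_frac p le_max_iff_disj intro: mono simp del: of_int_add)
qed

lemma padic_abs_add_less:
  "prime p \<Longrightarrow> padic_abs p x < e \<Longrightarrow> padic_abs p y < e \<Longrightarrow> padic_abs p (x + y) < e"
  using padic_abs_add [of p x y] by auto

lemma padic_abs_add_le:
  assumes "prime p" shows "padic_abs p (x + y) \<le> padic_abs p x + padic_abs p y"
  using padic_abs_add [OF assms, of x y] padic_abs_nonneg [of p x] padic_abs_nonneg [of p y]
  by linarith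

lemma padic_abs_triangle:
  assumes "prime p" shows "\<bar>padic_abs p x - padic_abs p y\<bar> \<le> padic_abs p (x - y)"
  using padic_abs_add_le [OF assms, of "x - y" y] padic_abs_add_le [OF assms, of "y - x" x]
  by (simp add: padic_abs_diff_commute)

lemma padic_abs_le_1:
  assumes p: "prime p" and "\<not> int p dvd snd (quotient_of x)"
  shows "padic_abs p x \<le> 1"
proof -
  have "real p powi (- int n) \<le> 1" for n
    using power_int_increasing [of "- int n" 0 "real p"] prime_ge_1_nat [OF p] by simp
  then show ?thesis
    using assms by (simp add: padic_abs_def not_dvd_imp_multiplicity_0)
qed

section \<open>The field of \<open>p\<close>-adic numbers as the completion of the rationals\<close>

definition padic_Cauchy :: "nat \<Rightarrow> (nat \<Rightarrow> rat) set" where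
  "padic_Cauchy p =
     {X. \<forall>e>0. \<exists>M. \<forall>m\<ge>M. \<forall>n\<ge>M. padic_abs p (X m - X n) < e}"

definition padic_rel :: "nat \<Rightarrow> ((nat \<Rightarrow> rat) \<times> (nat \<Rightarrow> rat)) set" where
  "padic_rel p =
     {(X, Y). X \<in> padic_Cauchy p \<and> Y \<in> padic_Cauchy p \<and>
              (\<lambda>n. padic_abs p (X n - Y n)) \<longlonglongrightarrow> 0}"

type_synonym padic = "(nat \<Rightarrow> rat) set"

definition Qp :: "nat \<Rightarrow> padic set" where
  "Qp p = padic_Cauchy p // padic_rel p"

definition padic_of_rat :: "nat \<Rightarrow> rat \<Rightarrow> padic" where
  "padic_of_rat p q = padic_rel p `` {\<lambda>n. q}"

definition padic_add :: "nat \<Rightarrow> padic \<Rightarrow> padic \<Rightarrow> padic" where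
  "padic_add p a b = (\<Union>X\<in>a. \<Union>Y\<in>b. padic_rel p `` {\<lambda>n. X n + Y n})"

definition padic_mult :: "nat \<Rightarrow> padic \<Rightarrow> padic \<Rightarrow> padic" where
  "padic_mult p a b = (\<Union>X\<in>a. \<Union>Y\<in>b. padic_rel p `` {\<lambda>n. X n * Y n})"

definition padic_uminus :: "nat \<Rightarrow> padic \<Rightarrow> padic" where
  "padic_uminus p a = (\<Union>X\<in>a. padic_rel p `` {\<lambda>n. - X n})"

definition padic_norm :: "nat \<Rightarrow> padic \<Rightarrow> real" where
  "padic_norm p a = (THE r. \<forall>X\<in>a. (\<lambda>n. padic_abs p (X n)) \<longlonglongrightarrow> r)"

definition Zp :: "nat \<Rightarrow> padic set" where
  "Zp p = {a \<in> Qp p. padic_norm p a \<le> 1}"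

text \<open>The value \<open>0\<close> off the carrier is there only because the locale \<^locale>\<open>Metric_space\<close> wants
  symmetry and nonnegativity on the whole type.\<close>

definition padic_dist :: "nat \<Rightarrow> padic \<Rightarrow> padic \<Rightarrow> real" where
  "padic_dist p a b =
     (if a \<in> Qp p \<and> b \<in> Qp p then padic_norm p (padic_add p a (padic_uminus p b)) else 0)"

definition padic_topology :: "nat \<Rightarrow> padic topology" where
  "padic_topology p = Metric_space.mtopology (Qp p) (padic_dist p)"

lemma padic_null_add:
  assumes p: "prime p"
    and "(\<lambda>n. padic_abs p (X n)) \<longlonglongrightarrow> 0" "(\<lambda>n. padic_abs p (Y n)) \<longlonglongrightarrow> 0"
  shows "(\<lambda>n. padic_abs p (X n + Y n)) \<longlonglongrightarrow> 0"
  by (rule tendsto_sandwich [OF _ _ tendsto_const tendsto_add_zero [OF assms(2,3)]])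
     (auto simp: padic_abs_add_le p)

lemma padic_Cauchy_const [simp]: "(\<lambda>n. q) \<in> padic_Cauchy p"
  by (auto simp: padic_Cauchy_def)

lemma padic_CauchyE:
  assumes "X \<in> padic_Cauchy p" "e > 0"
  obtains M where "\<And>m n. m \<ge> M \<Longrightarrow> n \<ge> M \<Longrightarrow> padic_abs p (X m - X n) < e"
  using assms unfolding padic_Cauchy_def by blast

lemma padic_Cauchy_uminus: "X \<in> padic_Cauchy p \<Longrightarrow> (\<lambda>n. - X n) \<in> padic_Cauchy p"
  by (simp add: padic_Cauchy_def padic_abs_diff_commute)

lemma padic_Cauchy_add:
  assumes p: "prime p" and X: "X \<in> padic_Cauchy p" and Y: "Y \<in> padic_Cauchy p"
  shows "(\<lambda>n. X n + Y n) \<in> padic_Cauchy p"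
  unfolding padic_Cauchy_def
proof clarify
  fix e :: real assume "e > 0"
  obtain M where "\<And>m n. m \<ge> M \<Longrightarrow> n \<ge> M \<Longrightarrow> padic_abs p (X m - X n) < e"
    using X \<open>e > 0\<close> by (rule padic_CauchyE) blast
  moreover obtain N where "\<And>m n. m \<ge> N \<Longrightarrow> n \<ge> N \<Longrightarrow> padic_abs p (Y m - Y n) < e"
    using Y \<open>e > 0\<close> by (rule padic_CauchyE) blast
  ultimately have "padic_abs p ((X m - X n) + (Y m - Y n)) < e" if "m \<ge> max M N" "n \<ge> max M N" for m n
    using that by (intro padic_abs_add_less p) auto
  then show "\<exists>M. \<forall>m\<ge>M. \<forall>n\<ge>M. padic_abs p (X m + Y m - (X n + Y n)) < e"
    by (intro exI [of _ "max M N"]) (simp add: algebra_simps)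
qed

lemma padic_Cauchy_diff:
  assumes "prime p" "X \<in> padic_Cauchy p" "Y \<in> padic_Cauchy p"
  shows "(\<lambda>n. X n - Y n) \<in> padic_Cauchy p"
  using padic_Cauchy_add [OF assms(1,2) padic_Cauchy_uminus [OF assms(3)]] by simp

lemma padic_Cauchy_bounded:
  assumes p: "prime p" and X: "X \<in> padic_Cauchy p"
  obtains B where "B > 0" "\<And>n. padic_abs p (X n) \<le> B"
proof -
  obtain M where M: "\<And>m n. m \<ge> M \<Longrightarrow> n \<ge> M \<Longrightarrow> padic_abs p (X m - X n) < 1"
    using X zero_less_one by (rule padic_CauchyE) blast
  define B where "B = 1 + (\<Sum>k\<le>M. padic_abs p (X k))"
  have S: "padic_abs p (X k) \<le> (\<Sum>k\<le>M. padic_abs p (X k))" if "k \<le> M" for k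
    using that by (intro member_le_sum) auto
  have "padic_abs p (X n) \<le> B" for n
  proof (cases "n \<le> M")
    case True
    then show ?thesis using S [of n] by (simp add: B_def)
  next
    case False
    then have "padic_abs p (X n - X M) < 1" by (intro M) auto
    then show ?thesis
      using padic_abs_add_le [OF p, of "X n - X M" "X M"] S [of M] by (simp add: B_def)
  qed
  moreover have "B > 0" by (simp add: B_def add_pos_nonneg sum_nonneg)
  ultimately show ?thesis using that by blast
qed

lemma padic_Cauchy_mult:
  assumes p: "prime p" and X: "X \<in> padic_Cauchy p" and Y: "Y \<in> padic_Cauchy p"
  shows "(\<lambda>n. X n * Y n) \<in> padic_Cauchy p"
  unfolding padic_Cauchy_def
proof clarify
  fix e :: real assume e: "e > 0"
  obtain B where B: "B > 0" "\<And>n. padic_abs p (X n) \<le> B"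
    using padic_Cauchy_bounded [OF p X] by blast
  obtain C where C: "C > 0" "\<And>n. padic_abs p (Y n) \<le> C"
    using padic_Cauchy_bounded [OF p Y] by blast
  have eBC: "e / B > 0" "e / C > 0" using e B C by simp_all
  obtain M where M: "\<And>m n. m \<ge> M \<Longrightarrow> n \<ge> M \<Longrightarrow> padic_abs p (X m - X n) < e / C"
    using X eBC(2) by (rule padic_CauchyE) blast
  obtain N where N: "\<And>m n. m \<ge> N \<Longrightarrow> n \<ge> N \<Longrightarrow> padic_abs p (Y m - Y n) < e / B"
    using Y eBC(1) by (rule padic_CauchyE) blast
  have "padic_abs p (X m * Y m - X n * Y n) < e" if mn: "m \<ge> max M N" "n \<ge> max M N" for m n
  proof -
    have "padic_abs p ((X m - X n) * Y m) \<le> padic_abs p (X m - X n) * C"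
      using C by (simp add: padic_abs_mult p mult_left_mono)
    also have "\<dots> < e" using M [of m n] mn C by (simp add: field_simps)
    finally have 1: "padic_abs p ((X m - X n) * Y m) < e" .
    have "padic_abs p (X n * (Y m - Y n)) \<le> B * padic_abs p (Y m - Y n)"
      using B by (simp add: padic_abs_mult p mult_right_mono)
    also have "\<dots> < e" using N [of m n] mn B by (simp add: field_simps)
    finally have 2: "padic_abs p (X n * (Y m - Y n)) < e" .
    show ?thesis
      using padic_abs_add_less [OF p 1 2] by (simp add: algebra_simps)
  qed
  then show "\<exists>M. \<forall>m\<ge>M. \<forall>n\<ge>M. padic_abs p (X m * Y m - X n * Y n) < e" by blast
qed

lemma equiv_padic_rel:
  assumes p: "prime p" shows "equiv (padic_Cauchy p) (padic_rel p)"
proof (rule equivI)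
  show "trans (padic_rel p)"
  proof (rule transI)
    fix X Y Z assume r: "(X, Y) \<in> padic_rel p" "(Y, Z) \<in> padic_rel p"
    have "(\<lambda>n. padic_abs p ((X n - Y n) + (Y n - Z n))) \<longlonglongrightarrow> 0"
      using r by (intro padic_null_add p) (auto simp: padic_rel_def)
    then show "(X, Z) \<in> padic_rel p"
      using r by (simp add: padic_rel_def)
  qed
qed (auto simp: refl_on_def sym_def padic_rel_def padic_abs_diff_commute)

lemma congruent2_padic_add:
  assumes p: "prime p"
  shows "congruent2 (padic_rel p) (padic_rel p) (\<lambda>X Y. padic_rel p `` {\<lambda>n. X n + Y n})"
proof (rule congruent2I')
  fix X X' Y Y' assume r: "(X, X') \<in> padic_rel p" "(Y, Y') \<in> padic_rel p"
  have "(\<lambda>n. padic_abs p ((X n - X' n) + (Y n - Y' n))) \<longlonglongrightarrow> 0"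
    using r by (intro padic_null_add p) (auto simp: padic_rel_def)
  then have "(\<lambda>n. X n + Y n, \<lambda>n. X' n + Y' n) \<in> padic_rel p"
    using r by (auto simp: padic_rel_def padic_Cauchy_add p algebra_simps)
  then show "padic_rel p `` {\<lambda>n. X n + Y n} = padic_rel p `` {\<lambda>n. X' n + Y' n}"
    by (rule equiv_class_eq [OF equiv_padic_rel [OF p]])
qed

lemma padic_null_mult:
  assumes p: "prime p" and "Y \<in> padic_Cauchy p" "(\<lambda>n. padic_abs p (X n)) \<longlonglongrightarrow> 0"
  shows "(\<lambda>n. padic_abs p (X n * Y n)) \<longlonglongrightarrow> 0"
proof -
  obtain B where B: "B > 0" "\<And>n. padic_abs p (Y n) \<le> B"
    using padic_Cauchy_bounded [OF p assms(2)] by blast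
  show ?thesis
    by (rule tendsto_sandwich [OF _ _ tendsto_const tendsto_mult_left_zero [OF assms(3), of B]])
       (auto simp: padic_abs_mult p B mult_left_mono)
qed

lemma congruent2_padic_mult:
  assumes p: "prime p"
  shows "congruent2 (padic_rel p) (padic_rel p) (\<lambda>X Y. padic_rel p `` {\<lambda>n. X n * Y n})"
proof (rule congruent2I')
  fix X X' Y Y' assume r: "(X, X') \<in> padic_rel p" "(Y, Y') \<in> padic_rel p"
  have "(\<lambda>n. padic_abs p ((X n - X' n) * Y n + (Y n - Y' n) * X' n)) \<longlonglongrightarrow> 0"
    using r by (intro padic_null_add padic_null_mult p) (auto simp: padic_rel_def)
  then have "(\<lambda>n. X n * Y n, \<lambda>n. X' n * Y' n) \<in> padic_rel p"
    using r by (auto simp: padic_rel_def padic_Cauchy_mult p algebra_simps)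
  then show "padic_rel p `` {\<lambda>n. X n * Y n} = padic_rel p `` {\<lambda>n. X' n * Y' n}"
    by (rule equiv_class_eq [OF equiv_padic_rel [OF p]])
qed

lemma congruent_padic_uminus:
  assumes p: "prime p"
  shows "congruent (padic_rel p) (\<lambda>X. padic_rel p `` {\<lambda>n. - X n})"
proof (rule congruentI)
  fix X Y assume r: "(X, Y) \<in> padic_rel p"
  then have "(\<lambda>n. - X n, \<lambda>n. - Y n) \<in> padic_rel p"
    by (auto simp: padic_rel_def padic_Cauchy_uminus padic_abs_diff_commute)
  then show "padic_rel p `` {\<lambda>n. - X n} = padic_rel p `` {\<lambda>n. - Y n}"
    by (rule equiv_class_eq [OF equiv_padic_rel [OF p]])
qed

lemma padic_add_class:
  assumes "prime p" "X \<in> padic_Cauchy p" "Y \<in> padic_Cauchy p"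
  shows "padic_add p (padic_rel p `` {X}) (padic_rel p `` {Y}) = padic_rel p `` {\<lambda>n. X n + Y n}"
  unfolding padic_add_def
  using UN_equiv_class2 [OF equiv_padic_rel equiv_padic_rel congruent2_padic_add] assms by simp

lemma padic_mult_class:
  assumes "prime p" "X \<in> padic_Cauchy p" "Y \<in> padic_Cauchy p"
  shows "padic_mult p (padic_rel p `` {X}) (padic_rel p `` {Y}) = padic_rel p `` {\<lambda>n. X n * Y n}"
  unfolding padic_mult_def
  using UN_equiv_class2 [OF equiv_padic_rel equiv_padic_rel congruent2_padic_mult] assms by simp

lemma padic_uminus_class:
  assumes "prime p" "X \<in> padic_Cauchy p"
  shows "padic_uminus p (padic_rel p `` {X}) = padic_rel p `` {\<lambda>n. - X n}"
  unfolding padic_uminus_def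
  using UN_equiv_class [OF equiv_padic_rel congruent_padic_uminus] assms by simp

lemma padic_norm_class:
  assumes p: "prime p" and X: "X \<in> padic_Cauchy p"
  shows "(\<lambda>n. padic_abs p (X n)) \<longlonglongrightarrow> padic_norm p (padic_rel p `` {X})"
proof -
  have "Cauchy (\<lambda>n. padic_abs p (X n))"
    unfolding Cauchy_def dist_real_def
  proof clarify
    fix e :: real assume "e > 0"
    with X obtain M where "\<And>m n. m \<ge> M \<Longrightarrow> n \<ge> M \<Longrightarrow> padic_abs p (X m - X n) < e"
      by (rule padic_CauchyE) blast
    then show "\<exists>M. \<forall>m\<ge>M. \<forall>n\<ge>M. \<bar>padic_abs p (X m) - padic_abs p (X n)\<bar> < e"
      by (meson padic_abs_triangle [OF p] order_le_less_trans)
  qed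
  then obtain r where r: "(\<lambda>n. padic_abs p (X n)) \<longlonglongrightarrow> r"
    using Cauchy_convergent_iff convergent_def by blast
  have XX: "X \<in> padic_rel p `` {X}"
    using equiv_class_self [OF equiv_padic_rel [OF p] X] .
  have "(\<lambda>n. padic_abs p (Y n)) \<longlonglongrightarrow> r" if "Y \<in> padic_rel p `` {X}" for Y
  proof -
    have n: "(\<lambda>n. padic_abs p (X n - Y n)) \<longlonglongrightarrow> 0" using that by (auto simp: padic_rel_def)
    have "(\<lambda>n. padic_abs p (X n) - padic_abs p (Y n)) \<longlonglongrightarrow> 0"
      by (rule Lim_null_comparison [OF _ n]) (auto simp: padic_abs_triangle p)
    from tendsto_diff [OF r this] show ?thesis by simp
  qed
  then have "padic_norm p (padic_rel p `` {X}) = r"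
    unfolding padic_norm_def using XX r by (intro the_equality) (auto intro: LIMSEQ_unique)
  then show ?thesis using r by simp
qed

lemma Qp_cases:
  assumes "a \<in> Qp p"
  obtains X where "X \<in> padic_Cauchy p" "a = padic_rel p `` {X}"
  using assms unfolding Qp_def by (auto elim: quotientE)

lemma class_in_Qp: "X \<in> padic_Cauchy p \<Longrightarrow> padic_rel p `` {X} \<in> Qp p"
  unfolding Qp_def by (rule quotientI)

lemma padic_of_rat_in_Qp [simp]: "padic_of_rat p q \<in> Qp p"
  by (simp add: padic_of_rat_def class_in_Qp)

lemma Qp_closed:
  assumes p: "prime p" and "a \<in> Qp p" "b \<in> Qp p"
  shows "padic_add p a b \<in> Qp p" "padic_mult p a b \<in> Qp p"
  using assms
  by (auto elim!: Qp_cases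
      simp: padic_add_class padic_mult_class padic_Cauchy_add padic_Cauchy_mult class_in_Qp)

lemma Qp_uminus:
  assumes p: "prime p" and "a \<in> Qp p" shows "padic_uminus p a \<in> Qp p"
  using assms by (auto elim!: Qp_cases simp: padic_uminus_class padic_Cauchy_uminus class_in_Qp)

lemma Qp_ring:
  assumes p: "prime p" and a: "a \<in> Qp p" and b: "b \<in> Qp p" and c: "c \<in> Qp p"
  shows "padic_add p (padic_add p a b) c = padic_add p a (padic_add p b c)"
    and "padic_add p a b = padic_add p b a"
    and "padic_add p (padic_of_rat p 0) a = a"
    and "padic_add p (padic_uminus p a) a = padic_of_rat p 0"
    and "padic_mult p (padic_mult p a b) c = padic_mult p a (padic_mult p b c)"
    and "padic_mult p a b = padic_mult p b a"
    and "padic_mult p (padic_of_rat p 1) a = a"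
    and "padic_mult p (padic_add p a b) c = padic_add p (padic_mult p a c) (padic_mult p b c)"
proof -
  obtain X where X: "X \<in> padic_Cauchy p" "a = padic_rel p `` {X}" using a by (rule Qp_cases)
  obtain Y where Y: "Y \<in> padic_Cauchy p" "b = padic_rel p `` {Y}" using b by (rule Qp_cases)
  obtain Z where Z: "Z \<in> padic_Cauchy p" "c = padic_rel p `` {Z}" using c by (rule Qp_cases)
  note s = X Y Z p padic_of_rat_def padic_add_class padic_mult_class padic_uminus_class
        padic_Cauchy_add padic_Cauchy_mult padic_Cauchy_uminus
  show "padic_add p (padic_add p a b) c = padic_add p a (padic_add p b c)"
    "padic_add p a b = padic_add p b a"
    "padic_add p (padic_of_rat p 0) a = a"
    "padic_add p (padic_uminus p a) a = padic_of_rat p 0"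
    "padic_mult p (padic_mult p a b) c = padic_mult p a (padic_mult p b c)"
    "padic_mult p a b = padic_mult p b a"
    "padic_mult p (padic_of_rat p 1) a = a"
    "padic_mult p (padic_add p a b) c = padic_add p (padic_mult p a c) (padic_mult p b c)"
    by (simp_all add: s algebra_simps)
qed

lemma Qp_ring_unary:
  assumes p: "prime p" and a: "a \<in> Qp p"
  shows "padic_add p (padic_of_rat p 0) a = a"
    and "padic_add p (padic_uminus p a) a = padic_of_rat p 0"
    and "padic_mult p (padic_of_rat p 1) a = a"
  using Qp_ring(3,4,7) [OF p a a a] by auto

lemma padic_norm_of_rat [simp]:
  assumes "prime p" shows "padic_norm p (padic_of_rat p q) = padic_abs p q"
  using padic_norm_class [OF assms padic_Cauchy_const, of q]
  by (simp add: padic_of_rat_def LIMSEQ_const_iff)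

lemma padic_of_rat_eq_iff:
  assumes p: "prime p" shows "padic_of_rat p q = padic_of_rat p r \<longleftrightarrow> q = r"
proof -
  have "padic_of_rat p q = padic_of_rat p r \<longleftrightarrow> (\<lambda>n. q, \<lambda>n. r) \<in> padic_rel p"
    unfolding padic_of_rat_def by (rule eq_equiv_class_iff [OF equiv_padic_rel [OF p]]) auto
  also have "\<dots> \<longleftrightarrow> q = r"
    by (simp add: padic_rel_def LIMSEQ_const_iff padic_abs_eq_0_iff p)
  finally show ?thesis .
qed

lemma padic_norm_nonneg:
  assumes p: "prime p" and a: "a \<in> Qp p" shows "0 \<le> padic_norm p a"
proof -
  obtain X where X: "X \<in> padic_Cauchy p" "a = padic_rel p `` {X}" using a by (rule Qp_cases)
  show ?thesis
    using padic_norm_class [OF p X(1)] unfolding X(2) by (rule LIMSEQ_le_const) auto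
qed

lemma padic_norm_eq_0_iff:
  assumes p: "prime p" and a: "a \<in> Qp p" shows "padic_norm p a = 0 \<longleftrightarrow> a = padic_of_rat p 0"
proof
  assume 0: "padic_norm p a = 0"
  obtain X where X: "X \<in> padic_Cauchy p" "a = padic_rel p `` {X}" using a by (rule Qp_cases)
  then have "(X, \<lambda>n. 0) \<in> padic_rel p"
    using padic_norm_class [OF p X(1)] 0 by (simp add: padic_rel_def)
  then show "a = padic_of_rat p 0"
    unfolding X padic_of_rat_def by (rule equiv_class_eq [OF equiv_padic_rel [OF p]])
qed (simp add: p)

lemma padic_norm_uminus:
  assumes p: "prime p" and a: "a \<in> Qp p" shows "padic_norm p (padic_uminus p a) = padic_norm p a"
proof -
  obtain X where X: "X \<in> padic_Cauchy p" "a = padic_rel p `` {X}" using a by (rule Qp_cases)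
  show ?thesis
    using padic_norm_class [OF p X(1)] padic_norm_class [OF p padic_Cauchy_uminus [OF X(1)]]
    by (simp add: X padic_uminus_class p LIMSEQ_unique)
qed

lemma padic_norm_mult:
  assumes p: "prime p" and a: "a \<in> Qp p" and b: "b \<in> Qp p"
  shows "padic_norm p (padic_mult p a b) = padic_norm p a * padic_norm p b"
proof -
  obtain X where X: "X \<in> padic_Cauchy p" "a = padic_rel p `` {X}" using a by (rule Qp_cases)
  obtain Y where Y: "Y \<in> padic_Cauchy p" "b = padic_rel p `` {Y}" using b by (rule Qp_cases)
  have "(\<lambda>n. padic_abs p (X n * Y n)) \<longlonglongrightarrow> padic_norm p a * padic_norm p b"
    unfolding padic_abs_mult [OF p] X(2) Y(2)
    by (intro tendsto_mult padic_norm_class p X Y)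
  then show ?thesis
    using padic_norm_class [OF p padic_Cauchy_mult [OF p X(1) Y(1)]]
    by (simp add: X Y padic_mult_class p LIMSEQ_unique)
qed

lemma padic_norm_add:
  assumes p: "prime p" and a: "a \<in> Qp p" and b: "b \<in> Qp p"
  shows "padic_norm p (padic_add p a b) \<le> max (padic_norm p a) (padic_norm p b)"
proof -
  obtain X where X: "X \<in> padic_Cauchy p" "a = padic_rel p `` {X}" using a by (rule Qp_cases)
  obtain Y where Y: "Y \<in> padic_Cauchy p" "b = padic_rel p `` {Y}" using b by (rule Qp_cases)
  have "(\<lambda>n. padic_abs p (X n + Y n)) \<longlonglongrightarrow> padic_norm p (padic_add p a b)"
    using padic_norm_class [OF p padic_Cauchy_add [OF p X(1) Y(1)]]
    by (simp add: X Y padic_add_class p)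
  moreover have "(\<lambda>n. max (padic_abs p (X n)) (padic_abs p (Y n)))
      \<longlonglongrightarrow> max (padic_norm p a) (padic_norm p b)"
    unfolding X(2) Y(2) by (intro tendsto_max padic_norm_class p X Y)
  ultimately show ?thesis
    by (rule LIMSEQ_le) (auto simp: padic_abs_add p)
qed

lemma Metric_space_Qp:
  assumes p: "prime p" shows "Metric_space (Qp p) (padic_dist p)"
proof -
  have sub: "padic_norm p (padic_add p a (padic_uminus p b)) =
             padic_norm p (padic_add p b (padic_uminus p a))"
    if a: "a \<in> Qp p" and b: "b \<in> Qp p" for a b
  proof -
    obtain X where X: "X \<in> padic_Cauchy p" "a = padic_rel p `` {X}" using a by (rule Qp_cases)
    obtain Y where Y: "Y \<in> padic_Cauchy p" "b = padic_rel p `` {Y}" using b by (rule Qp_cases)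
    have "padic_uminus p (padic_add p a (padic_uminus p b)) = padic_add p b (padic_uminus p a)"
      by (simp add: X Y p padic_add_class padic_uminus_class padic_Cauchy_diff
            padic_Cauchy_uminus)
    then show ?thesis
      using padic_norm_uminus [OF p, of "padic_add p a (padic_uminus p b)"] a b
      by (simp add: Qp_closed Qp_uminus p)
  qed
  show ?thesis
  proof
    fix a b c
    show "0 \<le> padic_dist p a b"
      by (simp add: padic_dist_def Qp_closed Qp_uminus padic_norm_nonneg p)
    show "padic_dist p a b = padic_dist p b a"
      by (simp add: padic_dist_def sub)
    assume ab: "a \<in> Qp p" "b \<in> Qp p"
    have "padic_add p a (padic_uminus p b) = padic_of_rat p 0 \<longleftrightarrow> a = b"
    proof
      assume "padic_add p a (padic_uminus p b) = padic_of_rat p 0"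
      then have "padic_add p (padic_add p a (padic_uminus p b)) b = b"
        using ab by (simp add: Qp_ring_unary p)
      then show "a = b"
        using Qp_ring(1,2) [OF p] Qp_ring_unary(1,2) [OF p] ab Qp_uminus [OF p] padic_of_rat_in_Qp by metis
    next
      assume "a = b" then show "padic_add p a (padic_uminus p b) = padic_of_rat p 0"
        using Qp_ring(2) [OF p] Qp_ring_unary(2) [OF p] ab Qp_uminus [OF p] by metis
    qed
    then show "padic_dist p a b = 0 \<longleftrightarrow> a = b"
      using ab by (simp add: padic_dist_def padic_norm_eq_0_iff Qp_closed Qp_uminus p)
    assume c: "c \<in> Qp p"
    obtain X where X: "X \<in> padic_Cauchy p" "a = padic_rel p `` {X}" using ab(1) by (rule Qp_cases)
    obtain Y where Y: "Y \<in> padic_Cauchy p" "b = padic_rel p `` {Y}" using ab(2) by (rule Qp_cases)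
    obtain Z where Z: "Z \<in> padic_Cauchy p" "c = padic_rel p `` {Z}" using c by (rule Qp_cases)
    have eq: "padic_add p a (padic_uminus p c) =
        padic_add p (padic_add p a (padic_uminus p b)) (padic_add p b (padic_uminus p c))"
      by (simp add: X Y Z p padic_add_class padic_uminus_class padic_Cauchy_diff padic_Cauchy_uminus)
    have "padic_norm p (padic_add p a (padic_uminus p c)) \<le>
        max (padic_norm p (padic_add p a (padic_uminus p b)))
            (padic_norm p (padic_add p b (padic_uminus p c)))"
      unfolding eq by (intro padic_norm_add p Qp_closed Qp_uminus ab c)
    moreover have "0 \<le> padic_norm p (padic_add p a (padic_uminus p b))"
      "0 \<le> padic_norm p (padic_add p b (padic_uminus p c))"
      using ab c by (simp_all add: padic_norm_nonneg p Qp_closed Qp_uminus)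
    ultimately show "padic_dist p a c \<le> padic_dist p a b + padic_dist p b c"
      using ab c by (auto simp: padic_dist_def)
  qed
qed

lemma Zp_closed:
  assumes p: "prime p" and "a \<in> Zp p" "b \<in> Zp p"
  shows "padic_add p a b \<in> Zp p" "padic_mult p a b \<in> Zp p"
  using assms padic_norm_add [OF p, of a b]
  by (auto simp: Zp_def Qp_closed padic_norm_mult padic_norm_nonneg mult_le_one)

lemma Zp_uminus: "prime p \<Longrightarrow> a \<in> Zp p \<Longrightarrow> padic_uminus p a \<in> Zp p"
  by (auto simp: Zp_def Qp_uminus padic_norm_uminus)

section \<open>The finite adeles\<close>

text \<open>Elements are families over all naturals that are \<open>undefined\<close> off the primes, so that equality
  of finite adeles is equality of their components at primes.\<close>

definition restricted_product :: "(nat \<Rightarrow> padic) set" where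
  "restricted_product =
     {x \<in> \<Pi>\<^sub>E p\<in>{p. prime p}. Qp p. finite {p. prime p \<and> x p \<notin> Zp p}}"

lemma restricted_productI:
  assumes "\<And>p. prime p \<Longrightarrow> x p \<in> Qp p" "finite {p. prime p \<and> x p \<notin> Zp p}"
  shows "(\<lambda>p\<in>{p. prime p}. x p) \<in> restricted_product"
proof -
  have "{p. prime p \<and> (\<lambda>p\<in>{p. prime p}. x p) p \<notin> Zp p} = {p. prime p \<and> x p \<notin> Zp p}"
    by auto
  then show ?thesis
    using assms unfolding restricted_product_def by simp
qed

lemma padic_of_rat_in_restricted_product:
  "(\<lambda>p\<in>{p. prime p}. padic_of_rat p q) \<in> restricted_product"
proof (rule restricted_productI)
  have d: "snd (quotient_of q) > 0" by (metis quotient_of_denom_pos prod.collapse)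
  have "finite {p::nat. int p dvd snd (quotient_of q)}"
  proof (rule finite_subset)
    show "{p::nat. int p dvd snd (quotient_of q)} \<subseteq> {..nat (snd (quotient_of q))}"
      using d by (auto dest: zdvd_imp_le)
  qed auto
  then show "finite {p. prime p \<and> padic_of_rat p q \<notin> Zp p}"
    by (rule rev_finite_subset) (auto simp: Zp_def intro: padic_abs_le_1)
qed auto

lemma restricted_product_map2:
  assumes x: "x \<in> restricted_product" and y: "y \<in> restricted_product"
    and Q: "\<And>p. prime p \<Longrightarrow> x p \<in> Qp p \<Longrightarrow> y p \<in> Qp p \<Longrightarrow> h p (x p) (y p) \<in> Qp p"
    and Z: "\<And>p. prime p \<Longrightarrow> x p \<in> Zp p \<Longrightarrow> y p \<in> Zp p \<Longrightarrow> h p (x p) (y p) \<in> Zp p"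
  shows "(\<lambda>p\<in>{p. prime p}. h p (x p) (y p)) \<in> restricted_product"
proof (rule restricted_productI)
  have "finite ({p. prime p \<and> x p \<notin> Zp p} \<union> {p. prime p \<and> y p \<notin> Zp p})"
    using x y by (simp add: restricted_product_def)
  then show "finite {p. prime p \<and> h p (x p) (y p) \<notin> Zp p}"
    by (rule rev_finite_subset) (use Z in blast)
  show "h p (x p) (y p) \<in> Qp p" if "prime p" for p
    using x y that by (intro Q) (auto simp: restricted_product_def)
qed

typedef finite_adele = restricted_product
  morphisms fa_comp Abs_finite_adele
  using padic_of_rat_in_restricted_product by blast

setup_lifting type_definition_finite_adele

lemma fa_comp_in_Qp: "prime p \<Longrightarrow> fa_comp x p \<in> Qp p"
  using fa_comp [of x] by (auto simp: restricted_product_def)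

lemma finite_adele_eqI:
  assumes "\<And>p. prime p \<Longrightarrow> fa_comp x p = fa_comp y p" shows "x = y"
  using assms fa_comp [of x] fa_comp [of y] unfolding restricted_product_def
  by (metis (no_types, lifting) PiE_ext fa_comp_inject mem_Collect_eq)

lift_definition fa_of_rat :: "rat \<Rightarrow> finite_adele" is
  "\<lambda>q. \<lambda>p\<in>{p. prime p}. padic_of_rat p q"
  by (rule padic_of_rat_in_restricted_product)

instantiation finite_adele :: comm_ring_1
begin

definition "(0 :: finite_adele) = fa_of_rat 0"

definition "(1 :: finite_adele) = fa_of_rat 1"

lift_definition plus_finite_adele :: "finite_adele \<Rightarrow> finite_adele \<Rightarrow> finite_adele" is
  "\<lambda>x y. \<lambda>p\<in>{p. prime p}. padic_add p (x p) (y p)"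
  by (rule restricted_product_map2) (auto intro: Qp_closed Zp_closed)

lift_definition times_finite_adele :: "finite_adele \<Rightarrow> finite_adele \<Rightarrow> finite_adele" is
  "\<lambda>x y. \<lambda>p\<in>{p. prime p}. padic_mult p (x p) (y p)"
  by (rule restricted_product_map2) (auto intro: Qp_closed Zp_closed)

lift_definition uminus_finite_adele :: "finite_adele \<Rightarrow> finite_adele" is
  "\<lambda>x. \<lambda>p\<in>{p. prime p}. padic_uminus p (x p)"
  subgoal for x
    using restricted_product_map2 [of x x "\<lambda>p a b. padic_uminus p a"]
    by (simp add: Qp_uminus Zp_uminus)
  done

definition "x - y = x + - (y :: finite_adele)"

lemma fa_comp_simps:
  assumes "prime p"
  shows "fa_comp 0 p = padic_of_rat p 0" "fa_comp 1 p = padic_of_rat p 1"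
    "fa_comp (x + y) p = padic_add p (fa_comp x p) (fa_comp y p)"
    "fa_comp (x * y) p = padic_mult p (fa_comp x p) (fa_comp y p)"
    "fa_comp (- x) p = padic_uminus p (fa_comp x p)"
  using assms
  by (simp_all add: zero_finite_adele_def one_finite_adele_def fa_of_rat.rep_eq
      plus_finite_adele.rep_eq times_finite_adele.rep_eq uminus_finite_adele.rep_eq)

instance
proof
  fix x y z :: finite_adele
  note c = fa_comp_simps fa_comp_in_Qp
  show "x + y + z = x + (y + z)"
    by (rule finite_adele_eqI) (simp add: c Qp_ring(1))
  show "x + y = y + x"
    by (rule finite_adele_eqI) (metis c Qp_ring(2))
  show "0 + x = x"
    by (rule finite_adele_eqI) (simp add: c Qp_ring_unary)
  show "- x + x = 0"
    by (rule finite_adele_eqI) (simp add: c Qp_ring_unary)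
  show "x - y = x + - y" by (rule minus_finite_adele_def)
  show "x * y * z = x * (y * z)"
    by (rule finite_adele_eqI) (simp add: c Qp_ring(5))
  show "x * y = y * x"
    by (rule finite_adele_eqI) (metis c Qp_ring(6))
  show "1 * x = x"
    by (rule finite_adele_eqI) (simp add: c Qp_ring_unary)
  show "(x + y) * z = x * z + y * z"
    by (rule finite_adele_eqI) (simp add: c Qp_ring(8))
  have "fa_comp 0 2 \<noteq> fa_comp 1 2"
    by (simp add: c padic_of_rat_eq_iff)
  then show "(0::finite_adele) \<noteq> 1" by auto
qed

end

text \<open>The base consists of the boxes \<open>\<Prod>\<^sub>p U\<^sub>p\<close> with all \<open>U\<^sub>p\<close> open in \<open>\<rat>\<^sub>p\<close> and almost all
  \<open>U\<^sub>p = \<int>\<^sub>p\<close>.\<close>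

instantiation finite_adele :: topological_space
begin

definition open_finite_adele :: "finite_adele set \<Rightarrow> bool" where
  "open_finite_adele = generate_topology
     {{x. \<forall>p. prime p \<longrightarrow> fa_comp x p \<in> U p} | U.
        (\<forall>p. prime p \<longrightarrow> openin (padic_topology p) (U p)) \<and>
        finite {p. prime p \<and> U p \<noteq> Zp p}}"

instance
  by intro_classes (auto simp: open_finite_adele_def
      intro: generate_topology.UNIV generate_topology.Int generate_topology.UN)

end

section \<open>The adeles and circle-valued functions\<close>

text \<open>Addition and topology on \<open>adele\<close> are the library's componentwise addition and product
  topology.\<close>

type_synonym adele = "real \<times> finite_adele"

definition adele_of_rat :: "rat \<Rightarrow> adele" where
  "adele_of_rat q = (of_rat q, fa_of_rat q)"

text \<open>\<open>C(\<A>/\<rat>, S\<^sup>1)\<close>, identified with the \<open>\<rat>\<close>-periodic continuous circle-valued functions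
  on the adeles.\<close>

definition adele_circle_maps :: "(adele \<Rightarrow> complex) set" where
  "adele_circle_maps =
     {g. continuous_on UNIV g \<and> (\<forall>x. g x \<in> sphere 0 1) \<and>
         (\<forall>x q. g (x + adele_of_rat q) = g x)}"

definition pre_periodic :: "(real \<Rightarrow> complex) \<Rightarrow> bool" where
  "pre_periodic f \<longleftrightarrow>
     continuous_on UNIV f \<and> (\<forall>x. f x \<in> sphere 0 1) \<and>
     (\<forall>e>0. \<exists>N::nat. N > 0 \<and>
        (\<forall>(k::int) x. cmod (f (x + of_int k * of_nat N) - f x) < e))"

definition circle_lift :: "(real \<Rightarrow> complex) \<Rightarrow> (real \<Rightarrow> real) \<Rightarrow> bool" where
  "circle_lift f F \<longleftrightarrow>
     continuous_on UNIV F \<and> (\<forall>x. exp (2 * of_real pi * \<i> * of_real (F x)) = f x)"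

definition gen_winding_number :: "(real \<Rightarrow> complex) \<Rightarrow> real" where
  "gen_winding_number f =
     (THE w. \<forall>F. circle_lift f F \<longrightarrow> ((\<lambda>x. (F x - F (- x)) / (2 * x)) \<longlongrightarrow> w) at_top)"

text \<open>For pre-periodic functions, lifts exist, and the limit in \<open>gen_winding_number\<close> exists and does
  not depend on the lift, so the definite description is never a junk value there.\<close>

lemma pre_periodic_lift_exists:
  assumes "pre_periodic f"
  obtains F where "circle_lift f F"
proof -
  have f: "continuous_on UNIV f" "\<And>x. norm (f x) = 1"
    using assms by (auto simp: pre_periodic_def)
  have "contractible (UNIV :: real set)" by (simp add: convex_imp_contractible)
  moreover have "f x \<noteq> 0" for x using f(2) [of x] by auto
  ultimately obtain G where G: "continuous_on UNIV G" "\<And>x. f x = exp (G x)"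
    using continuous_logarithm_on_contractible [OF f(1)] by (metis UNIV_I)
  have "Re (G x) = 0" for x
    using f(2) [of x] by (simp add: G(2))
  then have "G x = 2 * of_real pi * \<i> * of_real (Im (G x) / (2 * pi))" for x
    by (simp add: complex_eq_iff)
  moreover have "continuous_on UNIV (\<lambda>x. Im (G x) / (2 * pi))"
    using G(1) by (intro continuous_intros) auto
  ultimately have "circle_lift f (\<lambda>x. Im (G x) / (2 * pi))"
    unfolding circle_lift_def using G(2) by metis
  then show ?thesis using that by blast
qed

lemma near_integer:
  assumes "cmod (exp (2 * of_real pi * \<i> * of_real t) - 1) < 1"
  shows "\<bar>t - of_int (round t)\<bar> < 1/4"
proof (rule ccontr)
  assume n: "\<not> ?thesis"
  define s where "s = t - of_int (round t)"
  have s: "1/4 \<le> \<bar>s\<bar>" "\<bar>s\<bar> \<le> 1/2"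
    using n of_int_round_abs_le [of t] by (auto simp: s_def abs_minus_commute)
  have "pi * (1/4) \<le> pi * \<bar>s\<bar>" "pi * \<bar>s\<bar> \<le> pi * (1/2)"
    using s by (intro mult_left_mono; simp)+
  then have "cos (2 * pi * \<bar>s\<bar>) \<le> cos (pi / 2)"
    by (intro cos_monotone_0_pi_le) auto
  moreover have "cos (2 * pi * \<bar>s\<bar>) = cos (2 * pi * s)"
    by (cases "s \<ge> 0") auto
  moreover have "cos (2 * pi * s) = cos (2 * pi * t)"
  proof -
    have "2 * pi * t = 2 * pi * s + 2 * pi * of_int (round t)"
      by (simp add: s_def algebra_simps)
    then show ?thesis by (simp add: cos_add)
  qed
  ultimately have "Re (exp (2 * of_real pi * \<i> * of_real t)) \<le> 0"
    by (simp add: Re_exp)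
  moreover have "\<bar>Re (exp (2 * of_real pi * \<i> * of_real t) - 1)\<bar> < 1"
    using assms abs_Re_le_cmod order_le_less_trans by blast
  ultimately show False by simp
qed

lemma pre_periodic_lift_linear:
  assumes f: "pre_periodic f" and F: "circle_lift f F"
  obtains w B where "\<And>x. \<bar>F x - w * x\<bar> \<le> B"
proof -
  have contF: "continuous_on UNIV F"
    and expF: "\<And>x. f x = exp (2 * of_real pi * \<i> * of_real (F x))"
    using F by (auto simp: circle_lift_def)
  obtain N :: nat where N: "N > 0"
    and per: "\<And>(k::int) x. cmod (f (x + of_int k * of_nat N) - f x) < 1"
    using f unfolding pre_periodic_def by (meson zero_less_one)
  define G where "G = (\<lambda>(k::int) x. F (x + of_int k * of_nat N) - F x)"
  have near: "\<bar>G k x - of_int (round (G k x))\<bar> < 1/4" for k x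
  proof (rule near_integer)
    have "exp (2 * of_real pi * \<i> * of_real (G k x)) = f (x + of_int k * of_nat N) / f x"
      unfolding expF G_def by (simp add: exp_diff [symmetric] algebra_simps)
    moreover have "f x \<noteq> 0" by (simp add: expF)
    moreover have "cmod (f x) = 1" using f by (simp add: pre_periodic_def)
    ultimately have "cmod (exp (2 * of_real pi * \<i> * of_real (G k x)) - 1)
        = cmod (f (x + of_int k * of_nat N) - f x)"
      by (metis div_by_1 divide_self diff_divide_distrib norm_divide)
    then show "cmod (exp (2 * of_real pi * \<i> * of_real (G k x)) - 1) < 1"
      using per by simp
  qed
  have le: "\<not> round (G k x) < round (G k y)" for k x y
  proof
    assume l: "round (G k x) < round (G k y)"
    define h where "h = of_int (round (G k x)) + (1/2 :: real)"
    have "real_of_int (round (G k x)) + 1 \<le> of_int (round (G k y))" using l by linarith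
    then have h: "h \<in> {G k x..G k y}"
      using near [of k x] near [of k y] unfolding h_def atLeastAtMost_iff by linarith
    have "continuous_on UNIV (G k)"
      unfolding G_def
      by (intro continuous_intros continuous_on_compose2 [OF contF]) auto
    then have "connected (range (G k))" by (intro connected_continuous_image) auto
    then have "h \<in> range (G k)" using h connected_contains_Icc by blast
    then obtain z where z: "G k z = h" by auto
    obtain d :: int where "\<bar>h - of_int d\<bar> < 1/4" using near [of k z] unfolding z by blast
    then have "real_of_int d - of_int (round (G k x)) < 1" "real_of_int d - of_int (round (G k x)) > 0"
      unfolding h_def by linarith+
    then have "real_of_int (d - round (G k x)) < 1" "real_of_int (d - round (G k x)) > 0"
      by simp_all
    then show False
      unfolding of_int_less_1_iff of_int_0_less_iff by linarith
  qed
  define m where "m = (\<lambda>k. round (G k 0))"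
  have Gm: "\<bar>G k x - of_int (m k)\<bar> < 1/4" for k x
    using near [of k x] le [of k x 0] le [of k 0 x] unfolding m_def
    by (metis linorder_neqE)
  have step: "m (k + 1) = m k + m 1" for k
  proof -
    have "G (k + 1) 0 = G k 0 + G 1 (of_int k * of_nat N)"
      by (simp add: G_def algebra_simps)
    then have "\<bar>real_of_int (m (k + 1)) - of_int (m k) - of_int (m 1)\<bar> < 1"
      using Gm [of "k + 1" 0] Gm [of k 0] Gm [of 1 "of_int k * of_nat N"] by linarith
    then have "\<bar>real_of_int (m (k + 1) - m k - m 1)\<bar> < 1" by simp
    then have "\<bar>m (k + 1) - m k - m 1\<bar> < 1"
      unfolding of_int_abs [symmetric] of_int_less_1_iff .
    then show ?thesis by linarith
  qed
  have m0: "m 0 = 0" by (simp add: m_def G_def)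
  have mk: "m k = k * m 1" for k
  proof (induction k rule: int_induct [of _ 0])
    case (step1 i) then show ?case using step [of i] by (simp add: algebra_simps)
  next
    case (step2 i) then show ?case using step [of "i - 1"] by (simp add: algebra_simps)
  qed (simp add: m0)
  have "compact (F ` {0..real N})"
    by (intro compact_continuous_image continuous_on_subset [OF contF]) auto
  then obtain C where C: "\<And>r. r \<in> {0..real N} \<Longrightarrow> \<bar>F r\<bar> \<le> C"
    by (metis bounded_iff compact_imp_bounded imageI real_norm_def)
  define w where "w = of_int (m 1) / real N"
  have "\<bar>F x - w * x\<bar> \<le> C + 1/4 + \<bar>w\<bar> * real N" for x
  proof -
    define k where "k = \<lfloor>x / real N\<rfloor>"
    define r where "r = x - of_int k * real N"
    have "of_int k \<le> x / real N" "x / real N < of_int k + 1"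
      unfolding k_def by linarith+
    then have r: "r \<in> {0..real N}" using N by (simp add: r_def field_simps)
    have x: "x = r + of_int k * real N" by (simp add: r_def)
    have "F x - w * x = F r + (G k r - of_int (m k)) - w * r"
      using N unfolding mk [of k] by (simp add: G_def w_def x field_simps)
    moreover have "\<bar>w * r\<bar> \<le> \<bar>w\<bar> * real N"
      using r by (simp add: abs_mult mult_left_mono)
    ultimately show ?thesis using C [OF r] Gm [of k r] by linarith
  qed
  then show ?thesis using that by blast
qed

lemma circle_lift_unique:
  assumes "circle_lift f F" "circle_lift f F'"
  obtains c where "\<And>x. F' x = F x + c"
proof -
  have "\<exists>n::int. F' x - F x = of_int n" for x
  proof -
    have "exp (2 * of_real pi * \<i> * of_real (F' x)) = exp (2 * of_real pi * \<i> * of_real (F x))"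
      using assms by (simp add: circle_lift_def)
    then obtain n :: int where "2 * of_real pi * \<i> * of_real (F' x)
        = 2 * of_real pi * \<i> * of_real (F x) + (of_int (2 * n) * pi) * \<i>"
      unfolding exp_eq by blast
    from arg_cong [OF this, of Im]
    have "2 * pi * F' x = 2 * pi * F x + of_int (2 * n) * pi" by simp
    then have "pi * (F' x - F x - of_int n) = 0" by (simp add: algebra_simps)
    then show ?thesis by (intro exI [of _ n]) simp
  qed
  then have Z: "F' x - F x \<in> \<int>" for x by (auto simp: Ints_def)
  have "(\<lambda>x. F' x - F x) constant_on UNIV"
  proof (rule continuous_discrete_range_constant)
    show "continuous_on UNIV (\<lambda>x. F' x - F x)"
      using assms by (intro continuous_intros) (auto simp: circle_lift_def)
    show "\<exists>e>0. \<forall>y. y \<in> UNIV \<and> F' y - F y \<noteq> F' x - F x \<longrightarrow>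
        e \<le> norm ((F' y - F y) - (F' x - F x))" for x
      using Z by (intro exI [of _ 1]) (auto intro!: Ints_nonzero_abs_ge1)
  qed auto
  then obtain c where "\<And>x. F' x - F x = c" by (auto simp: constant_on_def)
  then have "\<And>x. F' x = F x + c" by (metis add.commute diff_add_cancel)
  then show ?thesis using that by blast
qed

lemma pre_periodic_gen_winding_number:
  assumes f: "pre_periodic f" and F: "circle_lift f F"
  shows "((\<lambda>x. (F x - F (- x)) / (2 * x)) \<longlongrightarrow> gen_winding_number f) at_top"
proof -
  obtain w B where wB: "\<And>x. \<bar>F x - w * x\<bar> \<le> B"
    using pre_periodic_lift_linear [OF f F] by blast
  have lim: "((\<lambda>x. (F x - F (- x)) / (2 * x)) \<longlongrightarrow> w) at_top"
  proof (rule LIM_zero_cancel, rule Lim_null_comparison)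
    show "((\<lambda>x. B / x) \<longlongrightarrow> 0) at_top"
      by (intro tendsto_divide_0 [OF tendsto_const] filterlim_at_top_imp_at_infinity filterlim_ident)
    show "\<forall>\<^sub>F x in at_top. norm ((F x - F (- x)) / (2 * x) - w) \<le> B / x"
      using eventually_gt_at_top [of 0]
    proof eventually_elim
      case (elim x)
      have "(F x - F (- x)) / (2 * x) - w = ((F x - w * x) - (F (- x) - w * (- x))) / (2 * x)"
        using elim by (simp add: field_simps)
      moreover have "\<bar>(F x - w * x) - (F (- x) - w * (- x))\<bar> \<le> 2 * B"
        using wB [of x] wB [of "- x"] by linarith
      ultimately show ?case using elim by (simp add: abs_divide field_simps)
    qed
  qed
  have all: "((\<lambda>x. (F' x - F' (- x)) / (2 * x)) \<longlongrightarrow> w) at_top" if F': "circle_lift f F'" for F'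
  proof -
    obtain c where "\<And>x. F' x = F x + c" using circle_lift_unique [OF F F'] by blast
    then show ?thesis using lim by simp
  qed
  have "gen_winding_number f = w"
    unfolding gen_winding_number_def
  proof (rule the_equality)
    fix v assume "\<forall>F. circle_lift f F \<longrightarrow> ((\<lambda>x. (F x - F (- x)) / (2 * x)) \<longlongrightarrow> v) at_top"
    then show "v = w" using F lim by (meson tendsto_unique trivial_limit_at_top_linorder)
  qed (use all in blast)
  then show ?thesis using lim by simp
qed

end

theory Submission
  imports Defs
begin

text \<open>Write \<open>U\<^sub>N = N \<cdot> \<Prod>\<^sub>p \<int>\<^sub>p\<close>. The closure of the integers in the finite adeles is compact and \<open>g\<close> is
  \<open>\<rat>\<close>-periodic, so for each \<open>\<epsilon>\<close> some \<open>N\<close> satisfies \<open>\<bar>g(x, y + u) - g(x, y)\<bar> < \<epsilon>\<close> for all real \<open>x\<close> and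
  all \<open>u \<in> U\<^sub>N\<close>. Taking \<open>u = - k N\<close> and using periodicity gives pre-periodicity. Strong approximation
  gives a rational \<open>q \<in> x\<^sub>f + U\<^sub>N\<close>; then \<open>g(\<cdot>, x\<^sub>f)\<close> is uniformly close to \<open>g(\<cdot>, q)\<close>, which is a real translate
  of \<open>g(\<cdot>, 0)\<close>, and neither a translation nor a perturbation of size less than \<open>1\<close> changes the winding
  number, since both change a lift by a bounded function (up to shifting its argument).\<close>

section \<open>Integrality at a prime\<close>

lemma padic_abs_frac_le_1:
  assumes p: "prime p" and b: "\<not> int p dvd b"
  shows "padic_abs p (of_int a / of_int b) \<le> 1"
proof (cases "a = 0")
  case False
  have "b \<noteq> 0" using b by auto
  moreover have "real p powi (- int n) \<le> 1" for n
    using power_int_increasing [of "- int n" 0 "real p"] prime_ge_1_nat [OF p] by simp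
  ultimately show ?thesis
    using p False b by (simp add: padic_abs_frac not_dvd_imp_multiplicity_0)
qed simp

lemma padic_abs_of_int_le_1:
  assumes "prime p" shows "padic_abs p (of_int a) \<le> 1"
  using padic_abs_frac_le_1 [OF assms, of 1 a] prime_gt_1_nat [OF assms] by simp

lemma padic_abs_dvd_le:
  assumes p: "prime p" and "a dvd b"
  shows "padic_abs p (of_int b) \<le> padic_abs p (of_int a)"
proof -
  obtain c where "b = a * c" using assms(2) by blast
  then show ?thesis
    using padic_abs_of_int_le_1 [OF p, of c]
    by (simp add: padic_abs_mult p mult_left_le)
qed

lemma padic_abs_prime_power:
  assumes p: "prime p" shows "padic_abs p (of_nat (p ^ k)) = (1 / real p) ^ k"
proof (induction k)
  case 0
  show ?case using padic_abs_frac [OF p, of 1 1] by simp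
next
  case (Suc k)
  have "multiplicity (int p) (int p) = 1"
    using p by (intro multiplicity_self) (auto simp: prime_gt_0_nat)
  then have "padic_abs p (of_nat p) = 1 / real p"
    using padic_abs_frac [OF p, of "int p" 1] prime_gt_0_nat [OF p]
    by (simp add: power_int_minus divide_inverse)
  then show ?case using Suc by (simp add: padic_abs_mult p)
qed

text \<open>Partial fractions: if \<open>r = a / (p^k * m)\<close> with \<open>p\<close> not
  dividing \<open>m\<close>, a Bezout relation \<open>u * m + v * p^k = 1\<close> splits
  \<open>r\<close> into \<open>a * u / p^k + a * v / m\<close>, and the second summand is integral
  at \<open>p\<close>.\<close>

lemma rat_prime_power_approx:
  assumes p: "prime p"
  obtains c k where "padic_abs p (r - of_int c / of_int (int p ^ k)) \<le> 1"
proof -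
  obtain a d where ad: "d \<noteq> 0" "r = of_int a / of_int d" by (rule rat_frac_cases)
  have "\<not> is_unit (int p)" using prime_gt_1_nat [OF p] by simp
  then obtain m where m: "d = int p ^ multiplicity (int p) d * m" "\<not> int p dvd m"
    using multiplicity_decompose' [OF ad(1)] by blast
  define k where "k = multiplicity (int p) d"
  have "coprime (int p) m" using p m(2) by (simp add: prime_imp_coprime)
  then have "coprime m (int p ^ k)" by (simp add: coprime_commute)
  then obtain u v where uv: "u * m + v * int p ^ k = 1"
    using bezout_int [of m "int p ^ k"] by (auto simp: coprime_iff_gcd_eq_1)
  have nz: "m \<noteq> 0" "p \<noteq> 0" using m(2) p by auto
  have uv': "(of_int u * of_int m + of_int v * of_nat p ^ k :: rat) = 1"
    using arg_cong [OF uv, of of_int] by simp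
  have "r - of_int (a * u) / of_int (int p ^ k) =
      of_int a * (1 - of_int u * of_int m) / (of_int m * of_nat p ^ k)"
    using nz unfolding ad(2) m(1) [folded k_def] by (simp add: field_simps)
  \<comment> \<open>Here \<open>1 - u * m = v * p^k\<close>, which cancels the power of
    \<open>p\<close> in the denominator.\<close>
  also have "\<dots> = of_int (a * v) / of_int m"
    using nz unfolding uv' [symmetric] by (simp add: field_simps)
  finally have "padic_abs p (r - of_int (a * u) / of_int (int p ^ k)) \<le> 1"
    using padic_abs_frac_le_1 [OF p m(2), of "a * v"] by simp
  then show ?thesis by (rule that)
qed

text \<open>A late term \<open>X M\<close> of a representing Cauchy sequence is a rational within
  distance 1 of the whole tail. Its polar part at \<open>p\<close> therefore serves for
  \<open>a\<close> too, by the ultrametric inequality, and the bound survives the limit.\<close>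

lemma Qp_prime_power_approx:
  assumes p: "prime p" and a: "a \<in> Qp p"
  obtains c k where "padic_norm p (padic_add p a
    (padic_uminus p (padic_of_rat p (of_int c / of_int (int p ^ k))))) \<le> 1"
proof -
  obtain X where X: "X \<in> padic_Cauchy p" "a = padic_rel p `` {X}" using a by (rule Qp_cases)
  obtain M where M: "\<And>m n. m \<ge> M \<Longrightarrow> n \<ge> M \<Longrightarrow> padic_abs p (X m - X n) < 1"
    using X(1) zero_less_one by (rule padic_CauchyE) blast
  obtain c k where ck: "padic_abs p (X M - of_int c / of_int (int p ^ k)) \<le> 1"
    using rat_prime_power_approx [OF p] by blast
  define q where "q = (of_int c / of_int (int p ^ k) :: rat)"
  have le: "padic_abs p (X n - q) \<le> 1" if "n \<ge> M" for n
    using padic_abs_add [OF p, of "X n - X M" "X M - q"] M [OF that order_refl] ck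
    unfolding q_def by simp
  have "(\<lambda>n. padic_abs p (X n - q)) \<longlonglongrightarrow> padic_norm p (padic_add p a (padic_uminus p (padic_of_rat p q)))"
    using padic_norm_class [OF p padic_Cauchy_diff [OF p X(1) padic_Cauchy_const [of q]]]
    by (simp add: X padic_of_rat_def p padic_add_class padic_uminus_class)
  then have "padic_norm p (padic_add p a (padic_uminus p (padic_of_rat p q))) \<le> 1"
    by (rule LIMSEQ_le_const2) (use le in blast)
  then show ?thesis using that unfolding q_def by blast
qed

section \<open>The subgroups of multiples of a positive integer\<close>

lemma fa_of_rat_comp: "prime p \<Longrightarrow> fa_comp (fa_of_rat q) p = padic_of_rat p q"
  by (simp add: fa_of_rat.rep_eq)

lemma fa_of_rat_add: "fa_of_rat (q + r) = fa_of_rat q + fa_of_rat r"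
  by (rule finite_adele_eqI)
     (simp add: fa_of_rat_comp fa_comp_simps padic_of_rat_def padic_add_class)

lemma fa_of_rat_mult: "fa_of_rat (q * r) = fa_of_rat q * fa_of_rat r"
  by (rule finite_adele_eqI)
     (simp add: fa_of_rat_comp fa_comp_simps padic_of_rat_def padic_mult_class)

lemma fa_of_rat_0: "fa_of_rat 0 = 0"
  by (simp add: zero_finite_adele_def)

lemma fa_of_rat_minus: "fa_of_rat (- q) = - fa_of_rat q"
  using fa_of_rat_add [of q "- q"] by (simp add: fa_of_rat_0 minus_unique)

lemma fa_of_rat_diff: "fa_of_rat (q - r) = fa_of_rat q - fa_of_rat r"
  using fa_of_rat_add [of q "- r"] by (simp add: fa_of_rat_minus)

text \<open>The group \<open>N \<cdot> \<Prod>\<^sub>p \<int>\<^sub>p\<close>.\<close>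

definition fa_multiples :: "nat \<Rightarrow> finite_adele set" where
  "fa_multiples N =
     {u. \<forall>p. prime p \<longrightarrow> padic_norm p (fa_comp u p) \<le> padic_abs p (of_nat N)}"

lemma fa_multiplesD:
  "u \<in> fa_multiples N \<Longrightarrow> prime p \<Longrightarrow> padic_norm p (fa_comp u p) \<le> padic_abs p (of_nat N)"
  by (simp add: fa_multiples_def)

lemma fa_multiples_add:
  assumes "u \<in> fa_multiples N" "v \<in> fa_multiples N" shows "u + v \<in> fa_multiples N"
  unfolding fa_multiples_def
proof clarify
  fix p :: nat assume p: "prime p"
  show "padic_norm p (fa_comp (u + v) p) \<le> padic_abs p (of_nat N)"
    using padic_norm_add [OF p fa_comp_in_Qp [OF p] fa_comp_in_Qp [OF p], of u v]
      fa_multiplesD [OF assms(1) p] fa_multiplesD [OF assms(2) p]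
    by (simp add: fa_comp_simps p)
qed

lemma fa_multiples_uminus: "u \<in> fa_multiples N \<Longrightarrow> - u \<in> fa_multiples N"
  by (simp add: fa_multiples_def fa_comp_simps padic_norm_uminus fa_comp_in_Qp)

lemma fa_multiples_antimono:
  assumes "M dvd N" "u \<in> fa_multiples N" shows "u \<in> fa_multiples M"
proof -
  have "padic_abs p (of_nat N) \<le> padic_abs p (of_nat M)" if "prime p" for p
    using padic_abs_dvd_le [OF that, of "int M" "int N"] assms(1) by simp
  then show ?thesis using assms(2) order_trans unfolding fa_multiples_def by blast
qed

lemma fa_of_int_multiples:
  assumes "int N dvd k" shows "fa_of_rat (of_int k) \<in> fa_multiples N"
  using padic_abs_dvd_le [OF _ assms] by (simp add: fa_multiples_def fa_of_rat_comp)

text \<open>Half of the statement that the groups \<open>fa_multiples N\<close> form a neighbourhood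
  base at 0, by induction on the generated topology. A box constrains \<open>u\<close> beyond
  integrality at only finitely many primes, and at each of these a power of \<open>p\<close>
  measures the allowed radius.\<close>

lemma open_contains_multiples:
  assumes "open V" "y \<in> V"
  shows "\<exists>N>0. \<forall>u\<in>fa_multiples N. y + u \<in> V"
  using assms(1) [unfolded open_finite_adele_def] assms(2)
proof (induction V)
  case UNIV
  show ?case by auto
next
  case (Int a b)
  then obtain M N where "M > 0" "\<forall>u\<in>fa_multiples M. y + u \<in> a"
    "N > 0" "\<forall>u\<in>fa_multiples N. y + u \<in> b" by blast
  then show ?case
    using fa_multiples_antimono [of M "M * N"] fa_multiples_antimono [of N "M * N"]
    by (intro exI [of _ "M * N"]) auto
next
  case (UN K)
  then obtain k where "k \<in> K" "y \<in> k" by blast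
  then obtain N where "N > 0" "\<forall>u\<in>fa_multiples N. y + u \<in> k" using UN.IH by blast
  then show ?case using \<open>k \<in> K\<close> by blast
next
  case (Basis s)
  then obtain U where s: "s = {x. \<forall>p. prime p \<longrightarrow> fa_comp x p \<in> U p}"
    and U: "\<And>p. prime p \<Longrightarrow> openin (padic_topology p) (U p)"
    and fin: "finite {p. prime p \<and> U p \<noteq> Zp p}" by blast
  define S where "S = {p. prime p \<and> U p \<noteq> Zp p}"
  have "\<exists>k. \<forall>u. u \<in> Qp p \<longrightarrow> padic_norm p u \<le> (1 / real p) ^ k \<longrightarrow> padic_add p (fa_comp y p) u \<in> U p"
    if p: "prime p" for p
  proof -
    interpret Metric_space "Qp p" "padic_dist p" by (rule Metric_space_Qp [OF p])
    have yU: "fa_comp y p \<in> U p" using Basis.prems p by (simp add: s)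
    then obtain r where r: "r > 0" "mball (fa_comp y p) r \<subseteq> U p"
      using U [OF p] unfolding padic_topology_def openin_mtopology by blast
    obtain k where k: "(1 / real p) ^ k < r"
      using real_arch_pow_inv [OF r(1), of "1 / real p"] prime_gt_1_nat [OF p] by auto
    have "padic_add p (fa_comp y p) u \<in> U p"
      if u: "u \<in> Qp p" "padic_norm p u \<le> (1 / real p) ^ k" for u
    proof -
      have y: "fa_comp y p \<in> Qp p" using p by (rule fa_comp_in_Qp)
      obtain X where X: "X \<in> padic_Cauchy p" "fa_comp y p = padic_rel p `` {X}" using y by (rule Qp_cases)
      obtain Y where Y: "Y \<in> padic_Cauchy p" "u = padic_rel p `` {Y}" using u(1) by (rule Qp_cases)
      \<comment> \<open>\<open>padic_dist\<close> is the norm of a difference, so the distance from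
        \<open>y\<close> to \<open>y + u\<close> at \<open>p\<close> is the norm of
        \<open>- u\<close>.\<close>
      have "padic_add p (fa_comp y p) (padic_uminus p (padic_add p (fa_comp y p) u)) = padic_uminus p u"
        unfolding X(2) Y(2) padic_add_class [OF p X(1) Y(1)]
          padic_uminus_class [OF p padic_Cauchy_add [OF p X(1) Y(1)]] padic_uminus_class [OF p Y(1)]
          padic_add_class [OF p X(1) padic_Cauchy_uminus [OF padic_Cauchy_add [OF p X(1) Y(1)]]]
        by simp
      then have "padic_dist p (fa_comp y p) (padic_add p (fa_comp y p) u) < r"
        using y u k p by (simp add: padic_dist_def Qp_closed padic_norm_uminus)
      then show ?thesis using r(2) y Qp_closed(1) [OF p y u(1)] by (auto simp: in_mball)
    qed
    then show ?thesis by blast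
  qed
  then obtain k where k: "\<And>p u. prime p \<Longrightarrow> u \<in> Qp p \<Longrightarrow> padic_norm p u \<le> (1 / real p) ^ k p \<Longrightarrow>
      padic_add p (fa_comp y p) u \<in> U p" by metis
  \<comment> \<open>At \<open>p\<close> in \<open>S\<close> divisibility by \<open>p ^ k p\<close>
    keeps \<open>y + u\<close> in the ball found above; at the other primes \<open>u\<close> is
    merely integral, which suffices because \<open>Zp p\<close> is closed under addition.\<close>
  define N where "N = (\<Prod>p\<in>S. p ^ k p)"
  have "N > 0" unfolding N_def by (rule prod_pos) (auto simp: S_def prime_gt_0_nat)
  moreover have "y + u \<in> s" if u: "u \<in> fa_multiples N" for u
    unfolding s
  proof clarify
    fix p :: nat assume p: "prime p"
    have "padic_add p (fa_comp y p) (fa_comp u p) \<in> U p"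
    proof (cases "p \<in> S")
      case True
      have "int (p ^ k p) dvd int N"
        unfolding N_def using fin True by (intro iffD2 [OF int_dvd_int_iff] dvd_prodI) (auto simp: S_def)
      then have "padic_abs p (of_nat N) \<le> padic_abs p (of_nat (p ^ k p))"
        using padic_abs_dvd_le [OF p, of "int (p ^ k p)" "int N"] by simp
      then show ?thesis
        using fa_multiplesD [OF u p] padic_abs_prime_power [OF p, of "k p"]
        by (intro k p fa_comp_in_Qp) auto
    next
      case False
      then have "U p = Zp p" using p by (simp add: S_def)
      moreover have "fa_comp y p \<in> U p" using Basis.prems p by (simp add: s)
      moreover have "fa_comp u p \<in> Zp p"
        using fa_multiplesD [OF u p] padic_abs_of_int_le_1 [OF p, of "int N"] p
        by (simp add: Zp_def fa_comp_in_Qp)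
      ultimately show ?thesis using p by (simp add: Zp_closed)
    qed
    then show "fa_comp (y + u) p \<in> U p" using p by (simp add: fa_comp_simps)
  qed
  ultimately show ?case by blast
qed

section \<open>Strong approximation\<close>

text \<open>The poles of \<open>x\<close> are removed one prime at a time. The correction at
  \<open>p\<close> has a power of \<open>p\<close> as denominator, so it is integral at every other
  prime and creates no new pole.\<close>

lemma strong_approximation_1:
  "\<exists>q. x - fa_of_rat q \<in> fa_multiples 1"
proof -
  have "finite {p. prime p \<and> fa_comp x p \<notin> Zp p}"
    using fa_comp [of x] by (simp add: restricted_product_def)
  \<comment> \<open>\<open>S\<close> may be any finite set containing the bad primes; this weaker
    condition is what the induction passes on after a prime has been repaired.\<close>
  then obtain S where "finite S" "\<And>p. prime p \<Longrightarrow> p \<notin> S \<Longrightarrow> fa_comp x p \<in> Zp p" by blast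
  then show ?thesis
  proof (induction S arbitrary: x rule: finite_induct)
    case empty
    have "padic_abs p 1 = 1" if "prime p" for p
      using padic_abs_prime_power [OF that, of 0] by simp
    then have "x - fa_of_rat 0 \<in> fa_multiples 1"
      using empty by (simp add: fa_of_rat_0 fa_multiples_def Zp_def)
    then show ?case by blast
  next
    case (insert p S)
    have "\<exists>r. \<forall>l. prime l \<longrightarrow> l \<notin> S \<longrightarrow> fa_comp (x - fa_of_rat r) l \<in> Zp l"
    proof (cases "prime p")
      case p: True
      obtain c k where ck: "padic_norm p (padic_add p (fa_comp x p)
          (padic_uminus p (padic_of_rat p (of_int c / of_int (int p ^ k))))) \<le> 1"
        using Qp_prime_power_approx [OF p fa_comp_in_Qp [OF p]] by blast
      define r where "r = (of_int c / of_int (int p ^ k) :: rat)"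
      have comp: "fa_comp (x - fa_of_rat r) l =
          padic_add l (fa_comp x l) (padic_uminus l (padic_of_rat l r))" if "prime l" for l
        using that by (simp add: diff_conv_add_uminus fa_comp_simps fa_of_rat_comp del: add_uminus_conv_diff)
      have "fa_comp (x - fa_of_rat r) l \<in> Zp l" if l: "prime l" "l \<notin> S" for l
      proof (cases "l = p")
        case True
        then show ?thesis
          using ck [folded r_def] unfolding True comp [OF p]
          by (simp add: Zp_def Qp_closed Qp_uminus fa_comp_in_Qp p)
      next
        case False
        then have "\<not> l dvd p ^ k"
          using l(1) p prime_dvd_power primes_dvd_imp_eq by blast
        then have "\<not> int l dvd int p ^ k"
          by (simp flip: of_nat_power)
        then have "padic_of_rat l r \<in> Zp l"
          using padic_abs_frac_le_1 [OF l(1), of "int p ^ k" c] l unfolding r_def by (simp add: Zp_def)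
        then show ?thesis
          unfolding comp [OF l(1)] using insert.prems l False by (simp add: Zp_closed Zp_uminus)
      qed
      then show ?thesis by blast
    next
      \<comment> \<open>\<open>S\<close> may contain non-primes, where there is nothing to
        repair.\<close>
      case False
      then show ?thesis using insert.prems by (intro exI [of _ 0]) (auto simp: fa_of_rat_0)
    qed
    then obtain r where "\<And>l. prime l \<Longrightarrow> l \<notin> S \<Longrightarrow> fa_comp (x - fa_of_rat r) l \<in> Zp l" by blast
    from insert.IH [OF this] obtain q where "x - fa_of_rat r - fa_of_rat q \<in> fa_multiples 1" by blast
    then have "x - fa_of_rat (r + q) \<in> fa_multiples 1" by (simp add: fa_of_rat_add algebra_simps)
    then show ?case by blast
  qed
qed

text \<open>Approximate \<open>x / N\<close> up to an integral adele, then multiply by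
  \<open>N\<close>.\<close>

lemma strong_approximation:
  assumes "N > 0"
  obtains q where "x - fa_of_rat q \<in> fa_multiples N"
proof -
  obtain q where q: "x * fa_of_rat (1 / of_nat N) - fa_of_rat q \<in> fa_multiples 1"
    using strong_approximation_1 by blast
  define u where "u = x * fa_of_rat (1 / of_nat N) - fa_of_rat q"
  have "fa_of_rat (of_nat N) * fa_of_rat (1 / of_nat N) = 1"
    using assms by (simp flip: fa_of_rat_mult add: one_finite_adele_def)
  then have "x - fa_of_rat (of_nat N * q) = fa_of_rat (of_nat N) * u"
    unfolding u_def fa_of_rat_mult by (simp add: algebra_simps)
  moreover have "fa_of_rat (of_nat N) * u \<in> fa_multiples N"
    unfolding fa_multiples_def
  proof clarify
    fix p :: nat assume p: "prime p"
    have "padic_norm p (fa_comp u p) \<le> 1"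
      using fa_multiplesD [OF q [folded u_def] p] padic_abs_of_int_le_1 [OF p, of 1] by simp
    then show "padic_norm p (fa_comp (fa_of_rat (of_nat N) * u) p) \<le> padic_abs p (of_nat N)"
      by (simp add: p fa_comp_simps fa_of_rat_comp padic_norm_mult fa_comp_in_Qp mult_left_le)
  qed
  ultimately show ?thesis using that by metis
qed

section \<open>Compactness of the closure of the integers\<close>

text \<open>Every prime power divides some factorial, so the sequence is Cauchy at all primes at
  once. The limits are integral at each prime, so together they form a finite adele, and the
  congruences modulo \<open>fact j\<close> pass to the limit.\<close>

lemma nested_residues_limit:
  fixes a :: "nat \<Rightarrow> int"
  assumes a: "\<And>j. fact j dvd a (Suc j) - a j"
  obtains z where "\<And>j. fa_of_rat (of_int (a j)) - z \<in> fa_multiples (fact j)"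
proof -
  have step: "fact j dvd a n - a j" if "j \<le> n" for j n
    using that
  proof (induction n rule: dec_induct)
    case (step n)
    have "(fact j :: int) dvd fact n" using step.hyps by (simp add: fact_dvd)
    then have "fact j dvd (a (Suc n) - a n) + (a n - a j)"
      using step.IH a dvd_trans by (intro dvd_add) blast+
    then show ?case by simp
  qed simp
  define X where "X n = (of_int (a n) :: rat)" for n
  have close: "padic_abs p (X j - X n) \<le> padic_abs p (of_nat (fact j))" if "prime p" "j \<le> n" for p j n
    using padic_abs_dvd_le [OF that(1) step [OF that(2)]] padic_abs_diff_commute [of p "X j" "X n"]
    by (simp add: X_def)
  have X: "X \<in> padic_Cauchy p" if p: "prime p" for p
    unfolding padic_Cauchy_def
  proof clarify
    fix e :: real assume e: "e > 0"
    obtain k where k: "(1 / real p) ^ k < e"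
      using real_arch_pow_inv [OF e, of "1 / real p"] prime_gt_1_nat [OF p] by auto
    \<comment> \<open>This choice works because \<open>p ^ k\<close> divides its own
      factorial.\<close>
    define M where "M = p ^ k"
    have "p ^ k dvd fact M"
      unfolding M_def using prime_gt_0_nat [OF p] by (intro dvd_fact) (auto simp: Suc_le_eq)
    then have "int (p ^ k) dvd int (fact M)" by (rule iffD2 [OF int_dvd_int_iff])
    then have "int (p ^ k) dvd fact M" by simp
    then have fM: "padic_abs p (of_nat (fact M)) < e"
      using padic_abs_dvd_le [OF p, of "int (p ^ k)" "fact M"] padic_abs_prime_power [OF p, of k] k by simp
    have "padic_abs p ((X m - X M) + (X M - X n)) < e" if "m \<ge> M" "n \<ge> M" for m n
      using close [OF p that(1)] close [OF p that(2)] fM padic_abs_diff_commute [of p "X m" "X M"]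
      by (intro padic_abs_add_less p) auto
    then show "\<exists>M. \<forall>m\<ge>M. \<forall>n\<ge>M. padic_abs p (X m - X n) < e" by auto
  qed
  have "padic_norm p (padic_rel p `` {X}) \<le> 1" if p: "prime p" for p
    by (rule LIMSEQ_le_const2 [OF padic_norm_class [OF p X [OF p]]])
       (auto simp: X_def padic_abs_of_int_le_1 p)
  then have "(\<lambda>p\<in>{p. prime p}. padic_rel p `` {X}) \<in> restricted_product"
    by (intro restricted_productI) (auto simp: Zp_def class_in_Qp X cong: conj_cong)
  then obtain z where z: "fa_comp z = (\<lambda>p\<in>{p. prime p}. padic_rel p `` {X})"
    using Abs_finite_adele_inverse by blast
  have "fa_of_rat (of_int (a j)) - z \<in> fa_multiples (fact j)" for j
    unfolding fa_multiples_def
  proof clarify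
    fix p :: nat assume p: "prime p"
    have "fa_comp (fa_of_rat (X j) - z) p = padic_rel p `` {\<lambda>n. X j - X n}"
      using p X [OF p]
      by (simp add: diff_conv_add_uminus fa_comp_simps fa_of_rat_comp z padic_of_rat_def
          padic_add_class padic_uminus_class padic_Cauchy_uminus del: add_uminus_conv_diff)
    moreover have "padic_norm p (padic_rel p `` {\<lambda>n. X j - X n}) \<le> padic_abs p (of_nat (fact j))"
      using close [OF p]
      by (intro LIMSEQ_le_const2 [OF padic_norm_class [OF p padic_Cauchy_diff [OF p padic_Cauchy_const X [OF p]]]])
         blast
    ultimately show "padic_norm p (fa_comp (fa_of_rat (of_int (a j)) - z) p) \<le> padic_abs p (of_nat (fact j))"
      by (simp add: X_def)
  qed
  then show ?thesis by (rule that)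
qed

text \<open>Bisection over residue classes modulo factorials: nested classes violating \<open>Q\<close> would shrink to
  a finite adele \<open>z\<close>. This takes the place of the compactness of \<open>\<Prod>\<^sub>p \<int>\<^sub>p\<close>.\<close>

lemma integer_compactness:
  assumes empty: "Q {}" and Un: "\<And>A B. Q A \<Longrightarrow> Q B \<Longrightarrow> Q (A \<union> B)"
    and mono: "\<And>A B. A \<subseteq> B \<Longrightarrow> Q B \<Longrightarrow> Q A"
    and loc: "\<And>z. \<exists>N>0. Q {b::int. fa_of_rat (of_int b) - z \<in> fa_multiples N}"
  shows "Q UNIV"
proof (rule ccontr)
  assume nQ: "\<not> Q UNIV"
  define R where "R a j = {b::int. fact j dvd b - a}" for a and j :: nat
  have UNION: "Q (\<Union>i\<in>I. A i)" if "finite I" "\<And>i. i \<in> I \<Longrightarrow> Q (A i)" for A and I :: "int set"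
    using that by (induction I rule: finite_induct) (auto intro: empty Un)
  have refine: "\<exists>a'. \<not> Q (R a' (Suc j)) \<and> fact j dvd a' - a" if "\<not> Q (R a j)" for a j
  proof (rule ccontr)
    assume n: "\<not> ?thesis"
    have "Q (R (a + fact j * i) (Suc j))" for i
    proof -
      have "fact j dvd (a + fact j * i) - a" by simp
      then show ?thesis using n by blast
    qed
    \<comment> \<open>The class of \<open>a\<close> modulo \<open>fact j\<close> is the union of
      \<open>j + 1\<close> classes modulo \<open>fact (Suc j)\<close>, so they cannot all satisfy
      \<open>Q\<close>.\<close>
    then have "Q (\<Union>i\<in>{0..int j}. R (a + fact j * i) (Suc j))"
      by (intro UNION) auto
    moreover have "R a j \<subseteq> (\<Union>i\<in>{0..int j}. R (a + fact j * i) (Suc j))"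
    proof
      fix b assume "b \<in> R a j"
      then obtain t where t: "b - a = fact j * t" unfolding R_def by blast
      have "b - (a + fact j * (t mod (1 + int j))) = fact j * (t - t mod (1 + int j))"
        using t by (simp add: algebra_simps)
      also have "\<dots> = fact (Suc j) * (t div (1 + int j))"
        by (simp add: minus_mod_eq_mult_div algebra_simps)
      finally have "b \<in> R (a + fact j * (t mod (1 + int j))) (Suc j)"
        unfolding R_def by simp
      moreover have "t mod (1 + int j) \<in> {0..int j}"
        using pos_mod_bound [of "1 + int j" t] pos_mod_sign [of "1 + int j" t]
        unfolding atLeastAtMost_iff by linarith
      ultimately show "b \<in> (\<Union>i\<in>{0..int j}. R (a + fact j * i) (Suc j))" by blast
    qed
    ultimately show False using mono that by blast
  qed
  \<comment> \<open>The choice can start because \<open>fact 0 = 1\<close>, so \<open>R a 0\<close>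
    is all of the integers.\<close>
  have "\<exists>a. \<forall>j. \<not> Q (R (a j) j) \<and> fact j dvd a (Suc j) - a j"
    by (rule dependent_nat_choice) (use nQ refine in \<open>auto simp: R_def\<close>)
  then obtain a where a: "\<And>j. \<not> Q (R (a j) j)" "\<And>j. fact j dvd a (Suc j) - a j" by blast
  obtain z where z: "\<And>j. fa_of_rat (of_int (a j)) - z \<in> fa_multiples (fact j)"
    using nested_residues_limit [OF a(2)] by blast
  obtain N where N: "N > 0" "Q {b::int. fa_of_rat (of_int b) - z \<in> fa_multiples N}"
    using loc by blast
  have "N dvd fact N" using N(1) by (intro dvd_fact) auto
  \<comment> \<open>Since \<open>N\<close> divides \<open>fact N\<close>, the bad class at stage
    \<open>N\<close> lies in the neighbourhood of \<open>z\<close> on which \<open>Q\<close>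
    holds.\<close>
  have "R (a N) N \<subseteq> {b. fa_of_rat (of_int b) - z \<in> fa_multiples N}"
  proof clarify
    fix b assume "b \<in> R (a N) N"
    then have "fa_of_rat (of_int (b - a N)) \<in> fa_multiples (fact N)"
      by (intro fa_of_int_multiples) (simp add: R_def)
    from fa_multiples_antimono [OF \<open>N dvd fact N\<close> fa_multiples_add [OF this z [of N]]]
    show "fa_of_rat (of_int b) - z \<in> fa_multiples N"
      by (simp add: fa_of_rat_diff)
  qed
  then show False using a(1) N(2) mono by blast
qed

section \<open>Uniform continuity in the finite direction\<close>

lemma adele_circle_maps_continuous_comp:
  assumes "g \<in> adele_circle_maps" "continuous_on S h"
  shows "continuous_on S (\<lambda>x. g (h x))"
proof -
  have "continuous_on UNIV g" using assms(1) unfolding adele_circle_maps_def by blast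
  then show ?thesis using assms(2) by (rule continuous_on_compose2) simp
qed

lemma adele_circle_maps_periodic:
  assumes "g \<in> adele_circle_maps"
  shows "g (x + of_rat q, y + fa_of_rat q) = g (x, y)"
proof -
  have "g ((x, y) + adele_of_rat q) = g (x, y)"
    using assms unfolding adele_circle_maps_def by blast
  then show ?thesis by (simp add: adele_of_rat_def)
qed

text \<open>An integer translation brings the real coordinate into \<open>{0..1}\<close> but
  replaces \<open>y\<close> by \<open>y + n\<close>. Compactness of the interval handles the real
  coordinate, and \<open>integer_compactness\<close> makes one \<open>N\<close> serve all
  \<open>n\<close>.\<close>

lemma adele_circle_maps_uniform:
  fixes y :: finite_adele
  assumes g: "g \<in> adele_circle_maps" and e: "e > 0"
  obtains N where "N > 0" "\<And>x u. u \<in> fa_multiples N \<Longrightarrow> dist (g (x, y + u)) (g (x, y)) < e"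
proof -
  define P where "P N b \<longleftrightarrow> (\<forall>x\<in>{0..1}. \<forall>u\<in>fa_multiples N.
      dist (g (x, y + fa_of_rat (of_int b) + u)) (g (x, y + fa_of_rat (of_int b))) < e)" for N and b :: int
  have P_mono: "P N b" if "P M b" "M dvd N" for M N b
    using that fa_multiples_antimono unfolding P_def by blast
  define Q where "Q A \<longleftrightarrow> (\<exists>N>0. \<forall>b\<in>A. P N b)" for A
  have "Q UNIV"
  proof (rule integer_compactness)
    show "Q {}" by (auto simp: Q_def)
    show "Q A" if "A \<subseteq> B" "Q B" for A B using that unfolding Q_def by blast
    show "Q (A \<union> B)" if AB: "Q A" "Q B" for A B
    proof -
      obtain M where M: "M > 0" "\<forall>b\<in>A. P M b" using AB(1) unfolding Q_def by blast
      obtain N where N: "N > 0" "\<forall>b\<in>B. P N b" using AB(2) unfolding Q_def by blast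
      have "\<forall>b\<in>A \<union> B. P (M * N) b" using M(2) N(2) P_mono dvd_triv_left dvd_triv_right by blast
      then show ?thesis using M(1) N(1) unfolding Q_def by (intro exI [of _ "M * N"]) simp
    qed
    show "\<exists>N>0. Q {b. fa_of_rat (of_int b) - z \<in> fa_multiples N}" for z
    proof -
      \<comment> \<open>Tube argument: with the compact interval as second factor, one neighbourhood
        \<open>V\<close> of \<open>y + z\<close> works for all \<open>x\<close> in it. The
        coordinates are swapped to fit this form.\<close>
      have "continuous_on (UNIV \<times> {0..1::real}) (\<lambda>t. g (snd t, fst t))"
        by (intro adele_circle_maps_continuous_comp [OF g] continuous_intros)
      moreover have "e / 4 > 0" using e by simp
      ultimately obtain V where V: "y + z \<in> V" "open V"
        "\<forall>v\<in>V \<inter> UNIV. \<forall>x\<in>{0..1}. dist (g (snd (v, x), fst (v, x))) (g (snd (y + z, x), fst (y + z, x))) \<le> e / 4"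
        by (rule continuous_on_prod_compactE [OF _ compact_Icc UNIV_I, of _ _ _ _ "y + z"]) blast
      obtain N where N: "N > 0" "\<And>u. u \<in> fa_multiples N \<Longrightarrow> y + z + u \<in> V"
        using open_contains_multiples [OF V(2,1)] by blast
      have "dist (g (x, y + fa_of_rat (of_int b) + u)) (g (x, y + fa_of_rat (of_int b))) < e"
        if x: "x \<in> {0..1}" and b: "fa_of_rat (of_int b) - z \<in> fa_multiples N"
          and u: "u \<in> fa_multiples N" for x b u
      proof -
        have "y + fa_of_rat (of_int b) \<in> V"
          using N(2) [OF b] by simp
        moreover have "y + fa_of_rat (of_int b) + u \<in> V"
          using N(2) [OF fa_multiples_add [OF b u]] by (simp add: algebra_simps)
        ultimately have "dist (g (x, y + fa_of_rat (of_int b))) (g (x, y + z)) \<le> e / 4"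
          "dist (g (x, y + fa_of_rat (of_int b) + u)) (g (x, y + z)) \<le> e / 4"
          using V(3) x by auto
        \<comment> \<open>Both points are compared with \<open>y + z\<close>; two non-strict bounds
          \<open>e / 4\<close> leave room for the strict bound \<open>e\<close>.\<close>
        then show ?thesis
          using e dist_triangle2 [of "g (x, y + fa_of_rat (of_int b) + u)" "g (x, y + fa_of_rat (of_int b))" "g (x, y + z)"]
          by linarith
      qed
      then show ?thesis using N(1) unfolding Q_def P_def by blast
    qed
  qed
  then obtain N where N: "N > 0" "\<And>x b u. x \<in> {0..1} \<Longrightarrow> u \<in> fa_multiples N \<Longrightarrow>
      dist (g (x, y + fa_of_rat (of_int b) + u)) (g (x, y + fa_of_rat (of_int b))) < e"
    unfolding Q_def P_def by blast
  have "dist (g (x, y + u)) (g (x, y)) < e" if u: "u \<in> fa_multiples N" for x u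
  proof -
    define n where "n = - \<lfloor>x\<rfloor>"
    have "x + of_int n \<in> {0..1}" unfolding n_def atLeastAtMost_iff by linarith
    from N(2) [OF this u, of n] show ?thesis
      using adele_circle_maps_periodic [OF g, of x "of_int n" y]
        adele_circle_maps_periodic [OF g, of x "of_int n" "y + u"]
      by (simp add: algebra_simps)
  qed
  then show ?thesis using N(1) that by blast
qed

lemma adele_circle_maps_pre_periodic:
  assumes g: "g \<in> adele_circle_maps"
  shows "pre_periodic (\<lambda>x. g (x, y))"
  unfolding pre_periodic_def
proof (intro conjI allI impI)
  show "continuous_on UNIV (\<lambda>x. g (x, y))"
    by (intro adele_circle_maps_continuous_comp [OF g] continuous_intros)
  show "g (x, y) \<in> sphere 0 1" for x using g unfolding adele_circle_maps_def by blast
  fix e :: real assume "e > 0"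
  then obtain N where N: "N > 0" "\<And>x u. u \<in> fa_multiples N \<Longrightarrow> dist (g (x, y + u)) (g (x, y)) < e"
    using adele_circle_maps_uniform [OF g] by blast
  have "cmod (g (x + of_int k * of_nat N, y) - g (x, y)) < e" for k :: int and x
  proof -
    have "dist (g (x, y + fa_of_rat (of_int (- k * int N)))) (g (x, y)) < e"
      by (intro N fa_of_int_multiples) simp
    \<comment> \<open>Adding the rational \<open>- k * N\<close> to both coordinates trades the real
      translation for a finite one.\<close>
    moreover have "g (x, y + fa_of_rat (of_int (- k * int N))) = g (x + of_int k * of_nat N, y)"
      using adele_circle_maps_periodic [OF g, of "x + of_int k * of_nat N" "of_int (- k * int N)" y]
      by (simp add: of_rat_minus of_rat_mult)
    ultimately show ?thesis by (simp add: dist_norm)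
  qed
  then show "\<exists>N>0. \<forall>(k::int) x. cmod (g (x + of_int k * of_nat N, y) - g (x, y)) < e"
    using N(1) by blast
qed

section \<open>Stability of the generalized winding number\<close>

text \<open>The symmetric difference quotient differs from \<open>w\<close> by at most
  \<open>2 * B / (2 * x)\<close>. Winding numbers can thus be compared through lifts, up to bounded
  errors.\<close>

lemma gen_winding_number_eqI:
  assumes f: "pre_periodic f" and F: "circle_lift f F" and B: "\<And>x. \<bar>F x - w * x\<bar> \<le> B"
  shows "gen_winding_number f = w"
proof -
  have "((\<lambda>x. (F x - F (- x)) / (2 * x)) \<longlongrightarrow> w) at_top"
  proof (rule LIM_zero_cancel, rule Lim_null_comparison)
    show "((\<lambda>x. B / x) \<longlongrightarrow> 0) at_top"
      by (intro tendsto_divide_0 [OF tendsto_const] filterlim_at_top_imp_at_infinity filterlim_ident)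
    show "\<forall>\<^sub>F x in at_top. norm ((F x - F (- x)) / (2 * x) - w) \<le> B / x"
      using eventually_gt_at_top [of 0]
    proof eventually_elim
      case (elim x)
      have "(F x - F (- x)) / (2 * x) - w = ((F x - w * x) - (F (- x) - w * (- x))) / (2 * x)"
        using elim by (simp add: field_simps)
      moreover have "\<bar>(F x - w * x) - (F (- x) - w * (- x))\<bar> \<le> 2 * B"
        using B [of x] B [of "- x"] by linarith
      ultimately show ?case using elim by (simp add: abs_divide field_simps)
    qed
  qed
  then show ?thesis
    using pre_periodic_gen_winding_number [OF f F] tendsto_unique trivial_limit_at_top_linorder by blast
qed

text \<open>Identifies the slope supplied by \<open>pre_periodic_lift_linear\<close> with the
  winding number.\<close>

lemma gen_winding_number_bounded:
  assumes f: "pre_periodic f" and F: "circle_lift f F"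
  obtains B where "\<And>x. \<bar>F x - gen_winding_number f * x\<bar> \<le> B"
proof -
  obtain w B where wB: "\<And>x. \<bar>F x - w * x\<bar> \<le> B"
    using pre_periodic_lift_linear [OF f F] by blast
  then have "gen_winding_number f = w" by (rule gen_winding_number_eqI [OF f F])
  then show ?thesis using wB that by blast
qed

text \<open>The translated lift \<open>F (x + c)\<close> deviates from \<open>w * x\<close> by the
  old error plus the constant \<open>w * c\<close>.\<close>

lemma gen_winding_number_shift:
  assumes f: "pre_periodic f" and h: "pre_periodic (\<lambda>x. f (x + c))"
  shows "gen_winding_number (\<lambda>x. f (x + c)) = gen_winding_number f"
proof -
  obtain F where F: "circle_lift f F" using pre_periodic_lift_exists [OF f] by blast
  define w where "w = gen_winding_number f"
  obtain B where B: "\<And>x. \<bar>F x - w * x\<bar> \<le> B"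
    using gen_winding_number_bounded [OF f F] unfolding w_def by blast
  have "circle_lift (\<lambda>x. f (x + c)) (\<lambda>x. F (x + c))"
    using F unfolding circle_lift_def
    by (auto intro!: continuous_on_compose2 [of UNIV F] continuous_intros)
  moreover have "\<bar>F (x + c) - w * x\<bar> \<le> B + \<bar>w * c\<bar>" for x
    using B [of "x + c"] by (simp add: algebra_simps)
  ultimately show ?thesis
    unfolding w_def [symmetric] by (rule gen_winding_number_eqI [OF h])
qed

text \<open>The quotient \<open>h / f\<close> stays in the open unit disc around 1, where the
  principal logarithm is continuous. Adding its scaled imaginary part to a lift of \<open>f\<close>
  gives a lift of \<open>h\<close> at bounded distance.\<close>

lemma gen_winding_number_close:
  assumes f: "pre_periodic f" and h: "pre_periodic h" and close: "\<And>x. dist (h x) (f x) < 1"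
  shows "gen_winding_number h = gen_winding_number f"
proof -
  obtain F where F: "circle_lift f F" using pre_periodic_lift_exists [OF f] by blast
  define w where "w = gen_winding_number f"
  obtain B where B: "\<And>x. \<bar>F x - w * x\<bar> \<le> B"
    using gen_winding_number_bounded [OF f F] unfolding w_def by blast
  have nf: "norm (f x) = 1" "norm (h x) = 1" for x using f h by (auto simp: pre_periodic_def)
  have nz: "f x \<noteq> 0" "h x \<noteq> 0" for x using nf [of x] by auto
  define L where "L x = Ln (h x / f x)" for x
  have "norm (h x / f x - 1) < 1" for x
  proof -
    have "h x / f x - 1 = (h x - f x) / f x" using nz by (simp add: field_simps)
    then show ?thesis using close [of x] nf by (simp add: norm_divide dist_norm)
  qed
  then have "Re (h x / f x) > 0" for x
    using abs_Re_le_cmod [of "h x / f x - 1"] by (smt (verit) minus_complex.simps(1) one_complex.simps(1))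
  then have np: "h x / f x \<notin> \<real>\<^sub>\<le>\<^sub>0" for x
    by (metis complex_nonpos_Reals_iff not_less)
  have eL: "exp (L x) = h x / f x" for x unfolding L_def using nz by simp
  \<comment> \<open>Both functions take values on the circle, so the quotient has modulus 1 and its
    logarithm is purely imaginary.\<close>
  then have "Re (L x) = 0" for x
    using nf by (metis div_by_1 exp_eq_one_iff norm_divide norm_exp_eq_Re)
  then have L: "L x = 2 * of_real pi * \<i> * of_real (Im (L x) / (2 * pi))" for x
    by (simp add: complex_eq_iff)
  define H where "H x = F x + Im (L x) / (2 * pi)" for x
  have "circle_lift h H"
    unfolding circle_lift_def
  proof (intro conjI allI)
    have "continuous_on UNIV L"
      unfolding L_def using f h np nz
      by (intro continuous_on_Ln' continuous_on_divide) (auto simp: pre_periodic_def)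
    then show "continuous_on UNIV H"
      unfolding H_def using F by (intro continuous_intros) (auto simp: circle_lift_def)
    fix x
    have "exp (2 * of_real pi * \<i> * of_real (H x)) =
        exp (2 * of_real pi * \<i> * of_real (F x)) * exp (2 * of_real pi * \<i> * of_real (Im (L x) / (2 * pi)))"
      unfolding H_def by (simp add: algebra_simps flip: exp_add)
    also have "\<dots> = f x * (h x / f x)"
      using F unfolding L [symmetric] eL by (simp add: circle_lift_def)
    finally show "exp (2 * of_real pi * \<i> * of_real (H x)) = h x" using nz by simp
  qed
  moreover have "\<bar>H x - w * x\<bar> \<le> B + 1" for x
  proof -
    have "- pi < Im (L x)" "Im (L x) \<le> pi"
      unfolding L_def using nz by (auto intro: mpi_less_Im_Ln Im_Ln_le_pi)
    then have "\<bar>Im (L x) / (2 * pi)\<bar> \<le> 1" by (simp add: abs_le_iff field_simps)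
    then show ?thesis using B [of x] unfolding H_def by linarith
  qed
  ultimately show ?thesis
    unfolding w_def [symmetric] by (rule gen_winding_number_eqI [OF h])
qed

theorem theorem5p2:
  fixes g :: "adele \<Rightarrow> complex" and x\<^sub>f :: finite_adele
  assumes "g \<in> adele_circle_maps"
  shows "pre_periodic (\<lambda>x. g (x, x\<^sub>f)) \<and>
         gen_winding_number (\<lambda>x. g (x, x\<^sub>f)) = gen_winding_number (\<lambda>x. g (x, 0))"
proof
  note pp = adele_circle_maps_pre_periodic [OF assms]
  show "pre_periodic (\<lambda>x. g (x, x\<^sub>f))" by (rule pp)
  obtain N where N: "N > 0"
    "\<And>x u. u \<in> fa_multiples N \<Longrightarrow> dist (g (x, x\<^sub>f + u)) (g (x, x\<^sub>f)) < 1"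
    using adele_circle_maps_uniform [OF assms zero_less_one] by blast
  obtain q where "x\<^sub>f - fa_of_rat q \<in> fa_multiples N"
    using strong_approximation [OF N(1)] by blast
  \<comment> \<open>Take \<open>u = - (x\<^sub>f - fa_of_rat q)\<close>, so that
    \<open>x\<^sub>f + u\<close> is the rational point.\<close>
  then have "dist (g (x, fa_of_rat q)) (g (x, x\<^sub>f)) < 1" for x
    using N(2) [OF fa_multiples_uminus] by fastforce
  then have "gen_winding_number (\<lambda>x. g (x, fa_of_rat q)) = gen_winding_number (\<lambda>x. g (x, x\<^sub>f))"
    by (intro gen_winding_number_close pp)
  moreover have shift: "(\<lambda>x. g (x, fa_of_rat q)) = (\<lambda>x. g (x + of_rat (- q), 0))"
    using adele_circle_maps_periodic [OF assms, of _ q 0, of "_ + of_rat (- q)"]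
    by (simp add: of_rat_minus)
  moreover have "gen_winding_number (\<lambda>x. g (x + of_rat (- q), 0)) = gen_winding_number (\<lambda>x. g (x, 0))"
    \<comment> \<open>The translate is pre-periodic because, by \<open>shift\<close>, it is the
      restriction of \<open>g\<close> to the fibre over \<open>fa_of_rat q\<close>.\<close>
    using pp [of 0] pp [of "fa_of_rat q", unfolded shift] by (rule gen_winding_number_shift)
  ultimately show "gen_winding_number (\<lambda>x. g (x, x\<^sub>f)) = gen_winding_number (\<lambda>x. g (x, 0))"
    by simp
qed

end
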